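(* Let $(\sigma,\alpha)$ be a genus zero collection of hypermaps and let $M(\sigma,\alpha)$ be the collection of its medial maps. Then $$j(M(\sigma,\alpha);x)=x^{\kappa(\sigma,\alpha)}\,R(\sigma,\alpha;x,x).$$
   Context: Permutations act on a finite set and are composed from right to left; $z(\pi)$ is the number of cycles of $\pi$ (fixed points included). A collection of hypermaps $(\sigma,\alpha)$ on $\{1,\ldots,n\}$ is an ordered pair of permutations of $\{1,\ldots,n\}$; its connected components are the orbits of the group generated by $\sigma$ and $\alpha$, and $\kappa(\sigma,\alpha)$ is their number. It is a hypermap if $\kappa(\sigma,\alpha)=1$. The genus of a hypermap on $n$ points is defined by $n+2-2g(\sigma,\alpha)=z(\sigma)+z(\alpha)+z(\alpha^{-1}\sigma)$; a collection has genus zero if all its connected components have genus zero. A permutation $\beta$ is a refinement of $\alpha$ ($\beta\le\alpha$) if $\beta$ is obtained by replacing each cycle $\alpha_i$ of $\alpha$ by a permutation $\beta_i$ of the same set of $n_i$ points with $g(\alpha_i,\beta_i)=0$, i.e. $z(\beta_i)+z(\beta_i^{-1}\alpha_i)=n_i+1$. The Whitney polynomial is $$R(\sigma,\alpha;u,v)=\sum_{\beta\leq\alpha}u^{\kappa(\sigma,\beta)-\kappa(\sigma,\alpha)}\,v^{\kappa(\sigma,\beta)+n-z(\beta)-z(\sigma)}.$$ The medial map $M(\sigma,\alpha)=(\sigma',\alpha')$ is the pair of permutations of $\{1^-,1^+,\ldots,n^-,n^+\}$ given by: the cycles of $\sigma'$ (vertices) are all cycles $(i_1^-,i_1^+,i_2^-,i_2^+,\ldots,i_k^-,i_k^+)$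 where $(i_1,\ldots,i_k)$ is a cycle of $\alpha$; the cycles of $\alpha'$ (edges) are all $2$-cycles $(i^+,\sigma(i)^-)$. Each edge is directed from its positive endpoint to its negative endpoint, giving the underlying Eulerian digraph (directed medial graph). A noncrossing Eulerian state of $M(\sigma,\alpha)$ is a partitioning of the edges of the directed medial graph into closed (directed) paths that do not cross at any vertex. It is given by a unique coherent matching: a perfect matching of the signed points that matches each negative point to a positive point on the same cycle of $\sigma'$ and whose restriction to each cycle of $\sigma'$ is a noncrossing partition with respect to the cyclic order of that cycle; a path entering a vertex at $j^-$ leaves it at the positive point matched to $j^-$. Noncrossing Eulerian states are counted via their coherent matchings. The noncrossing circuit partition polynomial is $$j(M(\sigma,\alpha);x)=\sum_{k\ge 0} f_k\,x^k,$$ where $f_k$ is the number of noncrossing Eulerian states with $k$ cycles (closed paths). *)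

theory Defs
  imports
    "HOL-Combinatorics.Orbits"
    "HOL-Library.Disjoint_Sets"
    "HOL-Algebra.Sym_Groups"
    "HOL-Algebra.Group_Action"
    "HOL-Computational_Algebra.Polynomial"
begin

text \<open>
  A permutation of \<open>{1..n}\<close> is a function \<open>\<pi>\<close> with \<open>\<pi> permutes {1..n}\<close>. Cycles are represented by
  their sets of points. \<open>perm_cycles A \<pi>\<close> is meant for sets \<open>A\<close> that \<open>\<pi>\<close> maps onto themselves; it
  then lists the cycles of the restriction of \<open>\<pi>\<close> to \<open>A\<close>, fixed points included.
\<close>

definition perm_cycles :: "'a set \<Rightarrow> ('a \<Rightarrow> 'a) \<Rightarrow> 'a set set" where
  "perm_cycles A \<pi> = (\<lambda>x. Orbits.orbit \<pi> x) ` A"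

definition num_cycles :: "'a set \<Rightarrow> ('a \<Rightarrow> 'a) \<Rightarrow> nat" where
  "num_cycles A \<pi> = card (perm_cycles A \<pi>)"

definition hypermap_collection :: "nat \<Rightarrow> (nat \<Rightarrow> nat) \<Rightarrow> (nat \<Rightarrow> nat) \<Rightarrow> bool" where
  "hypermap_collection n \<sigma> \<alpha> \<longleftrightarrow> \<sigma> permutes {1..n} \<and> \<alpha> permutes {1..n}"

definition components :: "nat \<Rightarrow> (nat \<Rightarrow> nat) \<Rightarrow> (nat \<Rightarrow> nat) \<Rightarrow> nat set set" where
  "components n \<sigma> \<alpha> =
     Group_Action.orbits (subgroup_generated (sym_group n) {\<sigma>, \<alpha>}) {1..n} (\<lambda>g. g)"

definition num_components :: "nat \<Rightarrow> (nat \<Rightarrow> nat) \<Rightarrow> (nat \<Rightarrow> nat) \<Rightarrow> nat" where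
  "num_components n \<sigma> \<alpha> = card (components n \<sigma> \<alpha>)"

text \<open>
  The genus of the hypermap that \<open>(\<sigma>, \<alpha>)\<close> induces on a set \<open>C\<close> of points on which the group
  generated by \<open>\<sigma>\<close> and \<open>\<alpha>\<close> acts transitively, i.e. the solution \<open>g\<close> of
  \<open>|C| + 2 - 2 g = z(\<sigma>) + z(\<alpha>) + z(\<alpha>\<^sup>-\<^sup>1 \<sigma>)\<close>, all cycles being counted inside \<open>C\<close>.
\<close>

definition genus :: "'a set \<Rightarrow> ('a \<Rightarrow> 'a) \<Rightarrow> ('a \<Rightarrow> 'a) \<Rightarrow> rat" where
  "genus C \<sigma> \<alpha> =
     (of_nat (card C) + 2
        - (of_nat (num_cycles C \<sigma>) + of_nat (num_cycles C \<alpha>)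
             + of_nat (num_cycles C (Hilbert_Choice.inv \<alpha> \<circ> \<sigma>)))) / 2"

definition genus_zero_collection :: "nat \<Rightarrow> (nat \<Rightarrow> nat) \<Rightarrow> (nat \<Rightarrow> nat) \<Rightarrow> bool" where
  "genus_zero_collection n \<sigma> \<alpha> \<longleftrightarrow>
     hypermap_collection n \<sigma> \<alpha> \<and> (\<forall>C\<in>components n \<sigma> \<alpha>. genus C \<sigma> \<alpha> = 0)"

definition refinement :: "nat \<Rightarrow> (nat \<Rightarrow> nat) \<Rightarrow> (nat \<Rightarrow> nat) \<Rightarrow> bool" where
  "refinement n \<beta> \<alpha> \<longleftrightarrow>
     \<beta> permutes {1..n} \<and> (\<forall>C\<in>perm_cycles {1..n} \<alpha>. \<beta> ` C = C \<and> genus C \<alpha> \<beta> = 0)"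

text \<open>
  The Whitney polynomial, as a polynomial in \<open>u\<close> whose coefficients are polynomials in \<open>v\<close>:
  \<open>monom (monom 1 b) a\<close> stands for \<open>u\<^sup>a v\<^sup>b\<close>. The truncated subtractions are exact, since for a
  refinement \<open>\<beta>\<close> of \<open>\<alpha>\<close> both exponents are nonnegative integers.
\<close>

definition whitney_poly :: "nat \<Rightarrow> (nat \<Rightarrow> nat) \<Rightarrow> (nat \<Rightarrow> nat) \<Rightarrow> int poly poly" where
  "whitney_poly n \<sigma> \<alpha> =
     (\<Sum>\<beta> | refinement n \<beta> \<alpha>.
        monom
          (monom 1 (num_components n \<sigma> \<beta> + n - num_cycles {1..n} \<beta> - num_cycles {1..n} \<sigma>))
          (num_components n \<sigma> \<beta> - num_components n \<sigma> \<alpha>))"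

text \<open>\<open>subst_poly2 P p q\<close> is the value of the bivariate polynomial \<open>P(u, v)\<close> at \<open>u = p\<close>, \<open>v = q\<close>.\<close>

definition subst_poly2 :: "int poly poly \<Rightarrow> int poly \<Rightarrow> int poly \<Rightarrow> int poly" where
  "subst_poly2 P p q = poly (map_poly (\<lambda>c. pcompose c q) P) p"

text \<open>\<open>Neg i\<close> and \<open>Pos i\<close> are the signed points \<open>i\<^sup>-\<close> and \<open>i\<^sup>+\<close>.\<close>

datatype signed_point = Neg nat | Pos nat

definition signed_points :: "nat \<Rightarrow> signed_point set" where
  "signed_points n = Neg ` {1..n} \<union> Pos ` {1..n}"

text \<open>
  A cycle \<open>(i\<^sub>1, \<dots>, i\<^sub>k)\<close> of \<open>\<alpha>\<close> gives the cycle \<open>(i\<^sub>1\<^sup>-, i\<^sub>1\<^sup>+, \<dots>, i\<^sub>k\<^sup>-, i\<^sub>k\<^sup>+)\<close> of the vertex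
  permutation, which thus sends \<open>i\<^sup>-\<close> to \<open>i\<^sup>+\<close> and \<open>i\<^sup>+\<close> to \<open>\<alpha>(i)\<^sup>-\<close>; the edge permutation swaps
  \<open>i\<^sup>+\<close> and \<open>\<sigma>(i)\<^sup>-\<close>. Both are the identity outside the signed points of \<open>{1..n}\<close>.
\<close>

definition medial_map ::
    "nat \<Rightarrow> (nat \<Rightarrow> nat) \<Rightarrow> (nat \<Rightarrow> nat)
       \<Rightarrow> (signed_point \<Rightarrow> signed_point) \<times> (signed_point \<Rightarrow> signed_point)" where
  "medial_map n \<sigma> \<alpha> =
     (perm_restrict
        (\<lambda>p. case p of Neg i \<Rightarrow> Pos i | Pos i \<Rightarrow> Neg (\<alpha> i)) (signed_points n),
      perm_restrict
        (\<lambda>p. case p of Neg i \<Rightarrow> Pos (Hilbert_Choice.inv \<sigma> i) | Pos i \<Rightarrow> Neg (\<sigma> i))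
        (signed_points n))"

text \<open>
  \<open>a, b, c, d\<close> are distinct points met in this order when running once around a cycle of \<open>f\<close>
  (\<open>funpow_dist f a x\<close> is the number of steps from \<open>a\<close> to \<open>x\<close>).
\<close>

definition cyclically_ordered :: "('a \<Rightarrow> 'a) \<Rightarrow> 'a \<Rightarrow> 'a \<Rightarrow> 'a \<Rightarrow> 'a \<Rightarrow> bool" where
  "cyclically_ordered f a b c d \<longleftrightarrow>
     {b, c, d} \<subseteq> Orbits.orbit f a \<and>
     0 < funpow_dist f a b \<and>
     funpow_dist f a b < funpow_dist f a c \<and>
     funpow_dist f a c < funpow_dist f a d"

text \<open>The restriction of \<open>P\<close> to each cycle of \<open>f\<close> is noncrossing for the cyclic order.\<close>

definition noncrossing :: "('a \<Rightarrow> 'a) \<Rightarrow> 'a set set \<Rightarrow> bool" where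
  "noncrossing f P \<longleftrightarrow>
     (\<forall>B\<in>P. \<forall>C\<in>P. B \<noteq> C \<longrightarrow>
        \<not> (\<exists>a\<in>B. \<exists>b\<in>C. \<exists>c\<in>B. \<exists>d\<in>C. cyclically_ordered f a b c d))"

text \<open>
  Coherent matchings of a map on the signed points of \<open>{1..n}\<close> with vertex permutation \<open>f\<close>; they
  encode the noncrossing Eulerian states.
\<close>

definition coherent_matching ::
    "nat \<Rightarrow> (signed_point \<Rightarrow> signed_point) \<Rightarrow> signed_point set set \<Rightarrow> bool" where
  "coherent_matching n f \<mu> \<longleftrightarrow>
     partition_on (signed_points n) \<mu> \<and>
     (\<forall>B\<in>\<mu>. \<exists>i j. B = {Neg i, Pos j} \<and> Pos j \<in> Orbits.orbit f (Neg i)) \<and>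
     noncrossing f \<mu>"

text \<open>
  Walking along the closed paths of the state given by \<open>\<mu>\<close>, for the edge permutation \<open>e\<close>: a path
  entering a vertex at \<open>i\<^sup>-\<close> leaves it at the positive point matched to \<open>i\<^sup>-\<close>, and from a positive
  point it follows the directed edge to its negative endpoint. The closed paths are the cycles of
  this walk.
\<close>

definition state_walk ::
    "(signed_point \<Rightarrow> signed_point) \<Rightarrow> signed_point set set \<Rightarrow> signed_point \<Rightarrow> signed_point" where
  "state_walk e \<mu> p =
     (case p of Neg i \<Rightarrow> Pos (THE j. {Neg i, Pos j} \<in> \<mu>) | Pos i \<Rightarrow> e (Pos i))"

definition num_states ::
    "nat \<Rightarrow> (signed_point \<Rightarrow> signed_point) \<times> (signed_point \<Rightarrow> signed_point) \<Rightarrow> nat \<Rightarrow> nat" where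
  "num_states n M k =
     card {\<mu>. coherent_matching n (fst M) \<mu> \<and>
              num_cycles (signed_points n) (state_walk (snd M) \<mu>) = k}"

text \<open>Only finitely many \<open>num_states n M k\<close> are nonzero, so the sum is over all \<open>k \<ge> 0\<close>.\<close>

definition circuit_partition_poly ::
    "nat \<Rightarrow> (signed_point \<Rightarrow> signed_point) \<times> (signed_point \<Rightarrow> signed_point) \<Rightarrow> int poly" where
  "circuit_partition_poly n M =
     (\<Sum>k | num_states n M k \<noteq> 0. monom (int (num_states n M k)) k)"

end

theory Submission
  imports Defs
begin

text \<open>
  A state matching every \<open>i\<^sup>-\<close> to \<open>\<beta>\<^sup>-\<^sup>1(i)\<^sup>+\<close> has as closed paths the cycles of \<open>\<sigma> \<beta>\<^sup>-\<^sup>1\<close>.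

  Reading such a matching as a fixed-point free involution \<open>\<tau>\<close>, i.e. as a product of \<open>n\<close> disjoint
  transpositions each joining two points of one cycle of the vertex permutation \<open>\<zeta>\<close>, it is
  noncrossing iff every transposition splits a cycle when these are multiplied onto \<open>\<zeta>\<close> one after
  the other, i.e. iff \<open>z(\<zeta> \<tau>) = z(\<zeta>) + n\<close>. Since \<open>z(\<zeta>) = z(\<alpha>)\<close> and
  \<open>z(\<zeta> \<tau>) = z(\<beta>) + z(\<alpha> \<beta>\<^sup>-\<^sup>1)\<close>, this says exactly that \<open>\<beta>\<close> refines \<open>\<alpha>\<close>.

  For a refinement, \<open>\<alpha>\<close> arises from \<open>\<beta>\<close> by multiplying with transpositions that each join two cycles.
  Such a step never decreases the defect \<open>n + 2 \<kappa>(\<sigma>, \<beta>) - z(\<sigma>) - z(\<beta>) - z(\<sigma> \<beta>\<^sup>-\<^sup>1)\<close>, which is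
  \<open>0\<close> at \<open>\<beta> = id\<close> and hence nonnegative. So \<open>(\<sigma>, \<beta>)\<close> has genus zero if \<open>(\<sigma>, \<alpha>)\<close> has, and then
  \<open>z(\<sigma> \<beta>\<^sup>-\<^sup>1)\<close> is the exponent of \<open>x\<close> in the term of \<open>\<beta>\<close> on the right-hand side.
\<close>

section \<open>Classes of the group generated by two permutations\<close>

text \<open>For permutations the classes are the orbits of the generated group. With an equivalence
  closure, inclusions between such relations reduce to checking the generators.\<close>

definition linked :: "('a \<Rightarrow> 'a) \<Rightarrow> ('a \<Rightarrow> 'a) \<Rightarrow> 'a \<Rightarrow> 'a \<Rightarrow> bool" where
  "linked \<sigma> \<beta> = equivclp (\<lambda>x y. y = \<sigma> x \<or> y = \<beta> x)"

text \<open>The identity as first generator adds no link, so all facts about \<open>linked\<close>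
  apply to the cycles of a single permutation.\<close>

abbreviation same_cycle :: "('a \<Rightarrow> 'a) \<Rightarrow> 'a \<Rightarrow> 'a \<Rightarrow> bool" where
  "same_cycle \<equiv> linked (\<lambda>x. x)"

text \<open>For an equivalence \<open>E\<close> this is the equivalence generated by
  \<open>E\<close> and the pair \<open>a\<close>, \<open>b\<close>: a chain has to pass between them
  at most once.\<close>

definition merge :: "('a \<Rightarrow> 'a \<Rightarrow> bool) \<Rightarrow> 'a \<Rightarrow> 'a \<Rightarrow> 'a \<Rightarrow> 'a \<Rightarrow> bool" where
  "merge E a b x y \<longleftrightarrow> E x y \<or> E x a \<and> E b y \<or> E x b \<and> E a y"

definition num_classes :: "'a set \<Rightarrow> ('a \<Rightarrow> 'a \<Rightarrow> bool) \<Rightarrow> nat" where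
  "num_classes A E = card ((\<lambda>x. Collect (E x)) ` A)"

lemma equivp_linked: "equivp (linked \<sigma> \<beta>)"
  unfolding linked_def by simp

lemma linked_refl [simp, intro]: "linked \<sigma> \<beta> x x"
  using equivp_linked by (rule equivp_reflp)

lemma linked_sym: "linked \<sigma> \<beta> x y \<Longrightarrow> linked \<sigma> \<beta> y x"
  using equivp_linked by (rule equivp_symp)

lemma linked_trans: "linked \<sigma> \<beta> x y \<Longrightarrow> linked \<sigma> \<beta> y z \<Longrightarrow> linked \<sigma> \<beta> x z"
  using equivp_linked by (rule equivp_transp)

lemma linked_left: "linked \<sigma> \<beta> x (\<sigma> x)"
  and linked_right: "linked \<sigma> \<beta> x (\<beta> x)"
  unfolding linked_def by (auto intro: r_into_equivclp)

lemma linked_least: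
  assumes "equivp E" "\<And>x. E x (\<sigma> x)" "\<And>x. E x (\<beta> x)" "linked \<sigma> \<beta> x y"
  shows "E x y"
  using assms(4) unfolding linked_def
proof (induction rule: equivclp_induct)
  case base
  show ?case using assms(1) by (rule equivp_reflp)
next
  case (step y z)
  then have "E y z" using assms(1-3) by (metis equivp_symp)
  with step assms(1) show ?case by (metis equivp_transp)
qed

lemma linked_mono:
  assumes "\<And>x. linked \<sigma>' \<beta>' x (\<sigma> x)" "\<And>x. linked \<sigma>' \<beta>' x (\<beta> x)" "linked \<sigma> \<beta> x y"
  shows "linked \<sigma>' \<beta>' x y"
  using linked_least[OF equivp_linked assms] .

lemma same_cycle_imp_linked: "same_cycle \<beta> x y \<Longrightarrow> linked \<sigma> \<beta> x y"
  by (rule linked_mono) (auto intro: linked_right)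

lemma linked_inv:
  assumes "bij \<beta>"
  shows "linked \<sigma> (inv' \<beta>) = linked \<sigma> \<beta>"
proof (intro ext iffI)
  fix x y
  have 1: "linked \<sigma> \<beta> u (inv' \<beta> u)" for u
    using linked_right[of \<sigma> \<beta> "inv' \<beta> u"] assms by (simp add: bij_is_surj surj_f_inv_f linked_sym)
  have 2: "linked \<sigma> (inv' \<beta>) u (\<beta> u)" for u
    using linked_right[of \<sigma> "inv' \<beta>" "\<beta> u"] assms by (simp add: bij_is_inj linked_sym)
  show "linked \<sigma> (inv' \<beta>) x y \<Longrightarrow> linked \<sigma> \<beta> x y"
    by (rule linked_mono[rotated 2]) (auto intro: 1 linked_left)
  show "linked \<sigma> \<beta> x y \<Longrightarrow> linked \<sigma> (inv' \<beta>) x y"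
    by (rule linked_mono[rotated 2]) (auto intro: 2 linked_left)
qed

text \<open>In a permutation of finite support some power returns to the start, so forward orbits
  are symmetric and already form equivalence classes.\<close>

lemma orbit_eq_same_cycle:
  assumes "permutation \<pi>"
  shows "Orbits.orbit \<pi> x = Collect (same_cycle \<pi> x)"
proof (intro Set.set_eqI iffI)
  fix y assume "y \<in> Orbits.orbit \<pi> x"
  then show "y \<in> Collect (same_cycle \<pi> x)"
    by induction (auto intro: linked_right linked_trans)
next
  fix y assume *: "y \<in> Collect (same_cycle \<pi> x)"
  have "equivp (\<lambda>x y. y \<in> Orbits.orbit \<pi> x)"
    using assms by (intro equivpI reflpI sympI transpI)
      (auto intro: permutation_self_in_orbit orbit_trans orbit_swap)
  then show "y \<in> Orbits.orbit \<pi> x"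
    by (rule linked_least[where \<sigma> = "\<lambda>x. x" and \<beta> = \<pi>])
      (use * assms in \<open>auto intro: orbit.base permutation_self_in_orbit\<close>)
qed

lemma equivp_merge: "equivp E \<Longrightarrow> equivp (merge E a b)"
  by (intro equivpI reflpI sympI transpI; unfold merge_def)
    (meson equivp_reflp equivp_symp equivp_transp)+

lemma merge_same:
  assumes "equivp E" "E a b"
  shows "merge E a b = E"
  using assms by (auto simp: fun_eq_iff merge_def) (meson equivp_symp equivp_transp)+

text \<open>Only the images of \<open>a\<close> and \<open>b\<close> are exchanged, so each new step
  is an old step preceded by at most one passage between \<open>a\<close> and
  \<open>b\<close>.\<close>

lemma linked_transpose_le:
  assumes "linked \<sigma> (\<beta> \<circ> transpose a b) x y"
  shows "merge (linked \<sigma> \<beta>) a b x y"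
proof (rule linked_least[OF equivp_merge[OF equivp_linked] _ _ assms])
  show "merge (linked \<sigma> \<beta>) a b x (\<sigma> x)" for x
    by (simp add: merge_def linked_left)
  show "merge (linked \<sigma> \<beta>) a b x ((\<beta> \<circ> transpose a b) x)" for x
    by (auto simp: merge_def linked_right transpose_def)
qed

text \<open>From \<open>a\<close> the new permutation enters the old cycle of \<open>b\<close> at
  \<open>\<beta> b\<close> and follows it; \<open>a\<close> is not on that cycle, so nothing diverts
  it before it reaches \<open>b\<close>.\<close>

lemma same_cycle_transpose:
  assumes "permutation \<beta>" "\<not> same_cycle \<beta> a b"
  shows "same_cycle (\<beta> \<circ> transpose a b) a b"
proof -
  define \<rho> where "\<rho> = \<beta> \<circ> transpose a b"
  have \<rho>: "\<rho> a = \<beta> b" "y \<noteq> a \<Longrightarrow> y \<noteq> b \<Longrightarrow> \<rho> y = \<beta> y" for y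
    by (simp_all add: \<rho>_def)
  have "same_cycle \<rho> a y" if "y \<in> Orbits.orbit \<beta> b" for y
    using that
  proof induction
    case base
    show ?case using linked_right[of "\<lambda>x. x" \<rho> a] \<rho> by simp
  next
    case (step y)
    show ?case
    proof (cases "y = b")
      case True
      then show ?thesis using linked_right[of "\<lambda>x. x" \<rho> a] \<rho> by simp
    next
      case False
      have "y \<noteq> a"
        using step.hyps assms orbit_eq_same_cycle[OF assms(1), of b] linked_sym by fastforce
      with False have "\<rho> y = \<beta> y" by (rule \<rho>(2)[rotated])
      with step.IH show ?thesis by (metis linked_right linked_trans)
    qed
  qed
  from this[OF permutation_self_in_orbit[OF assms(1)]] show ?thesis unfolding \<rho>_def .
qed

text \<open>For the inclusion not covered by \<open>linked_transpose_le\<close>, that lemma is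
  applied backwards: the same transposition recovers \<beta> from the product, for which
  \<open>a\<close> and \<open>b\<close> are linked already, so that merging them changes
  nothing.\<close>

lemma linked_transpose:
  assumes "permutation \<beta>" "\<not> same_cycle \<beta> a b"
  shows "linked \<sigma> (\<beta> \<circ> transpose a b) = merge (linked \<sigma> \<beta>) a b"
proof (intro ext iffI)
  fix x y
  show "linked \<sigma> (\<beta> \<circ> transpose a b) x y \<Longrightarrow> merge (linked \<sigma> \<beta>) a b x y"
    by (rule linked_transpose_le)
  define \<rho> where "\<rho> = \<beta> \<circ> transpose a b"
  have \<beta>: "\<beta> = \<rho> \<circ> transpose a b" by (simp add: \<rho>_def comp_assoc)
  have ab: "linked \<sigma> \<rho> a b"
    using same_cycle_imp_linked[OF same_cycle_transpose[OF assms]] unfolding \<rho>_def .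
  have le: "linked \<sigma> \<beta> x y \<Longrightarrow> linked \<sigma> \<rho> x y" for x y
    unfolding \<beta> using linked_transpose_le[of \<sigma> \<rho> a b x y]
    by (simp only: merge_same[OF equivp_linked ab])
  show "linked \<sigma> (\<beta> \<circ> transpose a b) x y" if "merge (linked \<sigma> \<beta>) a b x y"
    using that ab le unfolding merge_def \<rho>_def[symmetric] by (meson linked_sym linked_trans)
qed

lemma permutation_transpose_comp:
  "permutation \<beta> \<Longrightarrow> permutation (\<beta> \<circ> transpose a b)"
  "permutation \<beta> \<Longrightarrow> permutation (transpose a b \<circ> \<beta>)"
  by (auto intro: permutation_compose permutation_swap_id)

text \<open>Inversion keeps the classes and turns the left factor into a right one.\<close>

lemma linked_transpose_left:
  assumes "permutation \<beta>" "\<not> same_cycle \<beta> a b"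
  shows "linked \<sigma> (transpose a b \<circ> \<beta>) = merge (linked \<sigma> \<beta>) a b"
proof -
  have bij: "bij \<beta>" "bij (transpose a b \<circ> \<beta>)"
    using assms by (auto intro!: permutation_bijective permutation_transpose_comp)
  have "linked \<sigma> (transpose a b \<circ> \<beta>) = linked \<sigma> (inv' \<beta> \<circ> transpose a b)"
    using linked_inv[OF bij(2), of \<sigma>] bij(1) by (simp add: o_inv_distrib)
  also have "\<dots> = merge (linked \<sigma> (inv' \<beta>)) a b"
    using assms linked_inv[OF bij(1)] by (intro linked_transpose) (auto intro: permutation_inverse)
  finally show ?thesis by (simp add: linked_inv[OF bij(1)])
qed

text \<open>The cycle (a, \<pi> a, ..., c, ...) is cut at \<open>a\<close> and \<open>c\<close>. As
  \<open>c\<close> is now sent to \<open>\<pi> a\<close>, its new cycle is the arc from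
  \<open>\<pi> a\<close> to \<open>c\<close>, without \<open>a\<close>.\<close>

lemma orbit_transpose:
  assumes "permutation \<pi>" "same_cycle \<pi> a c" "a \<noteq> c"
  shows "Orbits.orbit (\<pi> \<circ> transpose a c) c
    = {x \<in> Orbits.orbit \<pi> a. 0 < funpow_dist \<pi> a x \<and> funpow_dist \<pi> a x \<le> funpow_dist \<pi> a c}"
    (is "?L = ?R")
proof -
  let ?p = "funpow_dist \<pi> a c"
  define \<rho> where "\<rho> = \<pi> \<circ> transpose a c"
  have \<rho>_apply: "\<rho> a = \<pi> c" "\<rho> c = \<pi> a" "\<And>x. x \<noteq> a \<Longrightarrow> x \<noteq> c \<Longrightarrow> \<rho> x = \<pi> x"
    by (simp_all add: \<rho>_def)
  have c: "c \<in> Orbits.orbit \<pi> a"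
    using assms by (simp add: orbit_eq_same_cycle)
  have p: "(\<pi> ^^ ?p) a = c" by (rule funpow_dist_prop[OF c])
  have p0: "0 < ?p" using funpow_dist_0_eq[OF c] assms(3) by auto
  have inj: "inj_on (\<lambda>i. (\<pi> ^^ i) a) {0..?p}" by (rule inj_on_funpow_dist[OF c])
  \<comment> \<open>The iterates up to exponent \<open>?p\<close> are distinct, so the least
    exponent reaching such a point is the given one.\<close>
  have dist: "funpow_dist \<pi> a ((\<pi> ^^ i) a) = i" if "i \<le> ?p" for i
  proof -
    have le: "funpow_dist \<pi> a ((\<pi> ^^ i) a) \<le> i"
      unfolding funpow_dist_def by (rule Least_le) simp
    moreover have "(\<pi> ^^ funpow_dist \<pi> a ((\<pi> ^^ i) a)) a = (\<pi> ^^ i) a"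
      unfolding funpow_dist_def by (rule LeastI) simp
    ultimately show ?thesis using inj that by (auto simp: inj_on_def)
  qed
  have in_orb: "(\<pi> ^^ i) a \<in> Orbits.orbit \<pi> a" for i
    using assms(1) by (auto simp: orbit_altdef_permutation)
  have R: "?R = (\<lambda>i. (\<pi> ^^ i) a) ` {1..?p}"
  proof (rule subset_antisym)
    show "?R \<subseteq> (\<lambda>i. (\<pi> ^^ i) a) ` {1..?p}"
    proof
      fix x assume "x \<in> ?R"
      then show "x \<in> (\<lambda>i. (\<pi> ^^ i) a) ` {1..?p}"
        by (intro image_eqI[of _ _ "funpow_dist \<pi> a x"]) (auto simp: funpow_dist_prop)
    qed
    show "(\<lambda>i. (\<pi> ^^ i) a) ` {1..?p} \<subseteq> ?R"
      using dist in_orb by auto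
  qed
  have \<rho>_step: "\<rho> ((\<pi> ^^ i) a) = (\<pi> ^^ Suc i) a" if "0 < i" "i < ?p" for i
  proof -
    have "(\<pi> ^^ i) a \<noteq> (\<pi> ^^ 0) a" "(\<pi> ^^ i) a \<noteq> (\<pi> ^^ ?p) a"
      using that inj_on_eq_iff[OF inj, of i 0] inj_on_eq_iff[OF inj, of i ?p] by auto
    then show ?thesis using p by (simp add: \<rho>_apply)
  qed
  have last: "\<rho> ((\<pi> ^^ ?p) a) = (\<pi> ^^ 1) a" using p by (simp add: \<rho>_apply)
  have "Orbits.orbit \<rho> c \<subseteq> ?R"
  proof
    fix y assume "y \<in> Orbits.orbit \<rho> c"
    then show "y \<in> ?R" unfolding R
    proof induction
      case base
      then show ?case using last p p0 by (intro image_eqI[of _ _ 1]) auto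
    next
      case (step y)
      then obtain i where i: "y = (\<pi> ^^ i) a" "1 \<le> i" "i \<le> ?p" by auto
      show ?case
      proof (cases "i = ?p")
        case True
        then show ?thesis using last p0 i by (intro image_eqI[of _ _ 1]) auto
      next
        case False
        then show ?thesis using \<rho>_step[of i] i by (intro image_eqI[of _ _ "Suc i"]) auto
      qed
    qed
  qed
  moreover have "(\<pi> ^^ Suc i) a \<in> Orbits.orbit \<rho> c" if "Suc i \<le> ?p" for i
    using that
  proof (induction i)
    case 0
    show ?case using last p orbit.base[of \<rho> c] by simp
  next
    case (Suc i)
    then have "\<rho> ((\<pi> ^^ Suc i) a) \<in> Orbits.orbit \<rho> c" by (intro orbit.step) simp
    then show ?case using \<rho>_step[of "Suc i"] Suc.prems by simp
  qed
  then have "?R \<subseteq> Orbits.orbit \<rho> c" unfolding R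
    by (auto simp del: funpow.simps) (metis One_nat_def Suc_le_D)
  ultimately show ?thesis unfolding \<rho>_def by blast
qed

lemma same_cycle_split:
  assumes "permutation \<pi>" "same_cycle \<pi> a c" "a \<noteq> c"
  shows "\<not> same_cycle (\<pi> \<circ> transpose a c) a c"
proof
  assume "same_cycle (\<pi> \<circ> transpose a c) a c"
  then have "a \<in> Orbits.orbit (\<pi> \<circ> transpose a c) c"
    using orbit_eq_same_cycle[OF permutation_transpose_comp(1)[OF assms(1)]] linked_sym by fastforce
  then show False
    by (simp add: orbit_transpose[OF assms] funpow_dist_0)
qed

text \<open>The transposition undoes itself: after the split, multiplying by it again joins two
  different cycles.\<close>

lemma same_cycle_unsplit:
  assumes "permutation \<pi>" "same_cycle \<pi> a c" "a \<noteq> c"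
  shows "same_cycle \<pi> = merge (same_cycle (\<pi> \<circ> transpose a c)) a c"
  using linked_transpose[OF permutation_transpose_comp(1)[OF assms(1)] same_cycle_split[OF assms], of "\<lambda>x. x"]
  by (simp add: comp_assoc)

section \<open>Counting equivalence classes\<close>

lemma Collect_class_eq_iff: "equivp E \<Longrightarrow> Collect (E x) = Collect (E y) \<longleftrightarrow> E x y"
  by (metis Collect_inj equivp_def)

lemma num_classes_merge:
  assumes "finite A" "equivp E" "a \<in> A" "b \<in> A" "\<not> E a b"
  shows "Suc (num_classes A (merge E a b)) = num_classes A E"
proof -
  let ?C = "\<lambda>x. Collect (E x)"
  have eq: "?C x = ?C y \<longleftrightarrow> E x y" for x y
    by (rule Collect_class_eq_iff[OF assms(2)])
  have E: "E x x" "E x y \<Longrightarrow> E y x" "E x y \<Longrightarrow> E y z \<Longrightarrow> E x z" for x y z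
    using assms(2) by (auto elim: equivpE dest: reflpD sympD transpD)
  \<comment> \<open>Only the classes of \<open>a\<close> and \<open>b\<close> change: both become
    their union.\<close>
  have C: "Collect (merge E a b x) = (if E x a \<or> E x b then ?C a \<union> ?C b else ?C x)" for x
  proof -
    have "merge E a b x = (\<lambda>y. if E x a \<or> E x b then E a y \<or> E b y else E x y)"
      unfolding merge_def by (intro ext) (smt (verit, best) E)
    then show ?thesis by (simp add: Collect_disj_eq)
  qed
  have img: "(\<lambda>x. Collect (merge E a b x)) ` A = insert (?C a \<union> ?C b) (?C ` A - {?C a, ?C b})"
    (is "?L = ?R")
  proof (intro Set.set_eqI iffI)
    fix X assume "X \<in> ?L"
    then obtain x where x: "x \<in> A" "X = Collect (merge E a b x)" by blast
    show "X \<in> ?R"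
    proof (cases "E x a \<or> E x b")
      case True
      then show ?thesis unfolding x(2) C by simp
    next
      case False
      then have "?C x \<noteq> ?C a" "?C x \<noteq> ?C b" unfolding eq by simp_all
      with False x(1) show ?thesis unfolding x(2) C by simp
    qed
  next
    fix X assume X: "X \<in> ?R"
    show "X \<in> ?L"
    proof (cases "X = ?C a \<union> ?C b")
      case True
      then have "X = Collect (merge E a b a)" unfolding C using E(1) by simp
      with assms(3) show ?thesis by (rule rev_image_eqI)
    next
      case False
      with X obtain x where x: "x \<in> A" "X = ?C x" "?C x \<noteq> ?C a" "?C x \<noteq> ?C b" by blast
      then have "X = Collect (merge E a b x)" unfolding C eq by simp
      with x(1) show ?thesis by (rule rev_image_eqI)
    qed
  qed
  \<comment> \<open>The union of two different classes is not an old class, so the insertion really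
    adds an element: two classes are lost and one is gained.\<close>
  have "?C a \<union> ?C b \<notin> ?C ` A"
  proof
    assume "?C a \<union> ?C b \<in> ?C ` A"
    then obtain x where x: "?C a \<union> ?C b = ?C x" by auto
    moreover have "a \<in> ?C a" "b \<in> ?C b" using assms(2) equivp_reflp by auto
    ultimately have "E x a" "E x b" by auto
    then show False using assms(2,5) by (meson equivp_symp equivp_transp)
  qed
  then have "card ?L = Suc (card (?C ` A - {?C a, ?C b}))"
    using assms(1) by (simp add: img)
  also have "card (?C ` A - {?C a, ?C b}) = card (?C ` A) - 2"
    using assms eq[of a b] by (subst card_Diff_subset) auto
  finally have "card ?L = Suc (card (?C ` A) - 2)" .
  moreover have "card {?C a, ?C b} \<le> card (?C ` A)"
    using assms by (intro card_mono) auto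
  then have "2 \<le> card (?C ` A)" using eq[of a b] assms(5) by simp
  ultimately show ?thesis by (simp add: num_classes_def)
qed

text \<open>A coarse class is the saturation under \<open>E'\<close> of a fine one, so saturation
  maps the fine classes onto the coarse ones.\<close>

lemma num_classes_antimono:
  assumes "finite A" "equivp E" "equivp E'" "\<And>x y. E x y \<Longrightarrow> E' x y"
  shows "num_classes A E' \<le> num_classes A E"
proof -
  have "Collect (E' x) = {z. \<exists>y \<in> Collect (E x). E' y z}" for x
    using assms(2-4) by (auto intro: equivp_reflp) (meson equivp_transp equivp_symp)+
  then have "(\<lambda>x. Collect (E' x)) ` A = (\<lambda>X. {z. \<exists>y \<in> X. E' y z}) ` (\<lambda>x. Collect (E x)) ` A"
    by (simp add: image_image)
  then show ?thesis unfolding num_classes_def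
    using assms(1) by (simp add: card_image_le)
qed

lemma card_image_cong_kernel:
  assumes "\<And>x y. x \<in> A \<Longrightarrow> y \<in> A \<Longrightarrow> f x = f y \<longleftrightarrow> g x = g y"
  shows "card (f ` A) = card (g ` A)"
proof (rule bij_betw_same_card)
  let ?i = "inv_into A f"
  have i: "?i (f x) \<in> A" "f (?i (f x)) = f x" if "x \<in> A" for x
    using that by (auto intro: inv_into_into f_inv_into_f)
  then have "g (?i (f x)) = g x" if "x \<in> A" for x
    using assms that by blast
  then show "bij_betw (\<lambda>X. g (?i X)) (f ` A) (g ` A)"
    unfolding bij_betw_def by (auto simp: inj_on_def assms image_image)
qed

text \<open>Points of one class may have the same image under \<open>h\<close>. This permits the
  two-to-one maps from the signed points to \<open>{1..n}\<close>.\<close>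

lemma num_classes_image:
  assumes "h ` A = B" "equivp E" "equivp E'"
    "\<And>x y. x \<in> A \<Longrightarrow> y \<in> A \<Longrightarrow> E' (h x) (h y) \<longleftrightarrow> E x y"
  shows "num_classes B E' = num_classes A E"
  unfolding num_classes_def assms(1)[symmetric] image_image
  by (rule card_image_cong_kernel) (simp add: Collect_class_eq_iff assms(2-4))

section \<open>Cycle counts under multiplication and the genus defect\<close>

lemma num_cycles_eq_num_classes:
  "permutation \<pi> \<Longrightarrow> num_cycles A \<pi> = num_classes A (same_cycle \<pi>)"
  by (simp add: num_cycles_def perm_cycles_def num_classes_def orbit_eq_same_cycle)

lemma num_cycles_join:
  assumes "finite A" "permutation \<pi>" "a \<in> A" "b \<in> A" "\<not> same_cycle \<pi> a b"
  shows "Suc (num_cycles A (\<pi> \<circ> transpose a b)) = num_cycles A \<pi>"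
  using num_classes_merge[OF assms(1) equivp_linked assms(3-5)] assms(2)
  by (simp add: num_cycles_eq_num_classes permutation_transpose_comp linked_transpose[OF assms(2,5)])

lemma num_cycles_split:
  assumes "finite A" "permutation \<pi>" "a \<in> A" "b \<in> A" "same_cycle \<pi> a b" "a \<noteq> b"
  shows "num_cycles A (\<pi> \<circ> transpose a b) = Suc (num_cycles A \<pi>)"
  using num_cycles_join[OF assms(1) permutation_transpose_comp(1)[OF assms(2)] assms(3,4)
      same_cycle_split[OF assms(2,5,6)]]
  by (simp add: comp_assoc)

lemma num_cycles_transpose_le:
  assumes "finite A" "permutation \<pi>" "a \<in> A" "b \<in> A"
  shows "num_cycles A (\<pi> \<circ> transpose a b) \<le> Suc (num_cycles A \<pi>)"
    and "num_cycles A \<pi> \<le> Suc (num_cycles A (\<pi> \<circ> transpose a b))"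
  using num_cycles_join[OF assms] num_cycles_split[OF assms]
  by (cases "a = b"; cases "same_cycle \<pi> a b"; force)+

lemma num_cycles_inv:
  assumes "permutation \<pi>"
  shows "num_cycles A (inv' \<pi>) = num_cycles A \<pi>"
  by (simp add: num_cycles_def perm_cycles_def orbit_inv_eq[OF assms])

lemma num_cycles_transpose_left:
  assumes "permutation \<pi>"
  shows "num_cycles A (transpose a b \<circ> \<pi>) = num_cycles A (inv' \<pi> \<circ> transpose a b)"
  using num_cycles_inv[OF permutation_transpose_comp(2)[OF assms], of A a b]
  by (simp add: o_inv_distrib permutation_bijective[OF assms])

lemma num_cycles_left_join:
  assumes "finite A" "permutation \<pi>" "a \<in> A" "b \<in> A" "\<not> same_cycle \<pi> a b"
  shows "Suc (num_cycles A (transpose a b \<circ> \<pi>)) = num_cycles A \<pi>"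
  using num_cycles_join[OF assms(1) permutation_inverse[OF assms(2)] assms(3,4)] assms(5)
  by (simp add: num_cycles_transpose_left[OF assms(2)] num_cycles_inv[OF assms(2)]
      linked_inv permutation_bijective[OF assms(2)])

lemma num_cycles_transpose_left_le:
  assumes "finite A" "permutation \<pi>" "a \<in> A" "b \<in> A"
  shows "num_cycles A \<pi> \<le> Suc (num_cycles A (transpose a b \<circ> \<pi>))"
  using num_cycles_transpose_le(2)[OF assms(1) permutation_inverse[OF assms(2)] assms(3,4)]
  by (simp add: num_cycles_transpose_left[OF assms(2)] num_cycles_inv[OF assms(2)])

lemma num_cycles_left_not_join:
  assumes "finite A" "permutation \<pi>" "a \<in> A" "b \<in> A" "same_cycle \<pi> a b"
  shows "num_cycles A \<pi> \<le> num_cycles A (transpose a b \<circ> \<pi>)"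
proof (cases "a = b")
  case False
  have "same_cycle (inv' \<pi>) a b"
    using assms by (simp add: linked_inv permutation_bijective)
  from num_cycles_split[OF assms(1) permutation_inverse[OF assms(2)] assms(3,4) this False]
  show ?thesis
    by (simp add: num_cycles_transpose_left[OF assms(2)] num_cycles_inv[OF assms(2)])
qed simp

section \<open>Cycle counts of products\<close>

lemma same_cycle_comp_swap:
  assumes "same_cycle (\<beta> \<circ> \<gamma>) x y"
  shows "same_cycle (\<gamma> \<circ> \<beta>) (\<gamma> x) (\<gamma> y)"
proof (rule linked_least[OF _ _ _ assms, of "\<lambda>x y. same_cycle (\<gamma> \<circ> \<beta>) (\<gamma> x) (\<gamma> y)"])
  show "equivp (\<lambda>x y. same_cycle (\<gamma> \<circ> \<beta>) (\<gamma> x) (\<gamma> y))"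
    by (intro equivpI reflpI sympI transpI) (auto intro: linked_sym linked_trans)
  show "same_cycle (\<gamma> \<circ> \<beta>) (\<gamma> x) (\<gamma> ((\<beta> \<circ> \<gamma>) x))" for x
    using linked_right[of "\<lambda>x. x" "\<gamma> \<circ> \<beta>" "\<gamma> x"] by simp
qed (rule linked_refl)

text \<open>The two products are conjugate by \<gamma>, which therefore maps the cycles of one to
  those of the other.\<close>

lemma num_cycles_comp_commute:
  assumes "finite A" "\<beta> permutes A" "\<gamma> permutes A"
  shows "num_cycles A (\<beta> \<circ> \<gamma>) = num_cycles A (\<gamma> \<circ> \<beta>)"
proof -
  have perm: "permutation \<beta>" "permutation \<gamma>"
    using assms by (auto simp: permutation_permutes)
  have "same_cycle (\<gamma> \<circ> \<beta>) (\<gamma> x) (\<gamma> y) \<longleftrightarrow> same_cycle (\<beta> \<circ> \<gamma>) x y" for x y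
  proof
    assume "same_cycle (\<gamma> \<circ> \<beta>) (\<gamma> x) (\<gamma> y)"
    \<comment> \<open>Swapping a second time moves both points one step along their own
      cycles.\<close>
    then have "same_cycle (\<beta> \<circ> \<gamma>) ((\<beta> \<circ> \<gamma>) x) ((\<beta> \<circ> \<gamma>) y)"
      using same_cycle_comp_swap by fastforce
    then show "same_cycle (\<beta> \<circ> \<gamma>) x y"
      by (meson linked_right linked_sym linked_trans)
  qed (rule same_cycle_comp_swap)
  then show ?thesis
    using perm num_classes_image[OF permutes_image[OF assms(3)] equivp_linked equivp_linked]
    by (simp add: num_cycles_eq_num_classes permutation_compose)
qed

lemma num_cycles_id: "finite A \<Longrightarrow> num_cycles A id = card A"
  unfolding num_cycles_def perm_cycles_def
  by (rule card_image) (simp add: inj_on_def orbit_eq_singleton_iff[THEN iffD2])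

text \<open>Every permutation of a finite set is built from the identity by joins only: splitting
  off the image \<open>\<gamma> x\<close> of a moved point as a fixed point leaves fewer moved
  points, and multiplying back joins two cycles.\<close>

lemma permutes_transpose_induct [consumes 2, case_names id transpose]:
  assumes "finite A" "\<gamma> permutes A" "P id"
    and step: "\<And>\<gamma> x y. \<gamma> permutes A \<Longrightarrow> x \<in> A \<Longrightarrow> y \<in> A \<Longrightarrow> \<not> same_cycle \<gamma> x y \<Longrightarrow> P \<gamma>
      \<Longrightarrow> P (\<gamma> \<circ> transpose x y)"
  shows "P \<gamma>"
  using assms(2)
proof (induction "card {x \<in> A. \<gamma> x \<noteq> x}" arbitrary: \<gamma> rule: less_induct)
  case less
  show ?case
  proof (cases "\<gamma> = id")
    case False
    then obtain x where x: "\<gamma> x \<noteq> x" by (auto simp: fun_eq_iff)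
    with less.prems have xA: "x \<in> A" "\<gamma> x \<in> A"
      by (metis permutes_not_in, metis permutes_in_image permutes_not_in)
    define \<gamma>' where "\<gamma>' = \<gamma> \<circ> transpose x (\<gamma> x)"
    have perm: "permutation \<gamma>" using assms(1) less.prems by (auto simp: permutation_permutes)
    have \<gamma>': "\<gamma>' permutes A"
      unfolding \<gamma>'_def using less.prems xA by (intro permutes_compose permutes_swap_id)
    have ns: "\<not> same_cycle \<gamma>' x (\<gamma> x)"
      unfolding \<gamma>'_def using perm x by (intro same_cycle_split) (auto intro: linked_right)
    have "{y \<in> A. \<gamma>' y \<noteq> y} \<subset> {y \<in> A. \<gamma> y \<noteq> y}"
    proof
      have "\<gamma> (\<gamma> x) \<noteq> \<gamma> x" using x less.prems by (auto dest: permutes_inj injD)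
      then show "{y \<in> A. \<gamma>' y \<noteq> y} \<subseteq> {y \<in> A. \<gamma> y \<noteq> y}"
        using x by (auto simp: \<gamma>'_def transpose_def split: if_splits)
      have "\<gamma> x \<notin> {y \<in> A. \<gamma>' y \<noteq> y}" by (simp add: \<gamma>'_def)
      with xA \<open>\<gamma> (\<gamma> x) \<noteq> \<gamma> x\<close>
      show "{y \<in> A. \<gamma>' y \<noteq> y} \<noteq> {y \<in> A. \<gamma> y \<noteq> y}" by blast
    qed
    then have "card {y \<in> A. \<gamma>' y \<noteq> y} < card {y \<in> A. \<gamma> y \<noteq> y}"
      using assms(1) by (intro psubset_card_mono) auto
    from step[OF \<gamma>' xA ns less.hyps[OF this \<gamma>']] show ?thesis
      by (simp add: \<gamma>'_def comp_assoc)
  qed (simp add: assms(3))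
qed

lemma permutes_transpose_comp:
  "\<beta> permutes A \<Longrightarrow> x \<in> A \<Longrightarrow> y \<in> A \<Longrightarrow> transpose x y \<circ> \<beta> permutes A"
  by (intro permutes_compose permutes_swap_id)

text \<open>This is the triangle inequality for the length
  \<open>card A - num_cycles A \<pi>\<close>. In the induction a transposition passes from \<gamma>
  to \<beta>; the former gains exactly one cycle and the latter loses at most one.\<close>

lemma num_cycles_comp_le:
  assumes "finite A" "\<gamma> permutes A" "\<beta> permutes A"
  shows "num_cycles A \<beta> + num_cycles A \<gamma> \<le> card A + num_cycles A (\<gamma> \<circ> \<beta>)"
  using assms
proof (induction \<gamma> arbitrary: \<beta> rule: permutes_transpose_induct)
  case id
  then show ?case by (simp add: num_cycles_id[OF assms(1), unfolded id_def])
next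
  case (transpose \<gamma> x y)
  have perm: "permutation \<beta>" "permutation \<gamma>"
    using assms(1) transpose by (auto simp: permutation_permutes)
  show ?case
    using transpose.IH[OF permutes_transpose_comp[OF transpose.prems transpose.hyps(2,3)]]
      num_cycles_join[OF assms(1) perm(2) transpose.hyps(2-4)]
      num_cycles_transpose_left_le[OF assms(1) perm(1) transpose.hyps(2,3)]
    by (simp add: comp_def)
qed

text \<open>For permutations of a finite set this is twice the sum of the genera of the components.
  It is an integer so that the differences are not truncated.\<close>

definition defect :: "'a set \<Rightarrow> ('a \<Rightarrow> 'a) \<Rightarrow> ('a \<Rightarrow> 'a) \<Rightarrow> int" where
  "defect A \<sigma> \<beta> = int (card A) + 2 * int (num_classes A (linked \<sigma> \<beta>))
     - int (num_cycles A \<sigma>) - int (num_cycles A \<beta>) - int (num_cycles A (\<sigma> \<circ> inv' \<beta>))"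

text \<open>If \<open>a\<close> and \<open>b\<close> are linked already, \<kappa> stays, \<beta>
  loses one cycle and the product gains at most one. Otherwise \<kappa> and both cycle counts drop
  by one, which leaves the defect unchanged.\<close>

lemma defect_join_mono:
  assumes "finite A" "\<sigma> permutes A" "\<beta> permutes A" "a \<in> A" "b \<in> A" "\<not> same_cycle \<beta> a b"
  shows "defect A \<sigma> \<beta> \<le> defect A \<sigma> (transpose a b \<circ> \<beta>)"
proof -
  have perm: "permutation \<beta>" "permutation (\<sigma> \<circ> inv' \<beta>)"
    using assms by (auto simp: permutation_permutes intro!: permutes_compose permutes_inv)
  have inv: "\<sigma> \<circ> inv' (transpose a b \<circ> \<beta>) = (\<sigma> \<circ> inv' \<beta>) \<circ> transpose a b"
    using perm by (simp add: o_inv_distrib permutation_bijective comp_assoc)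
  have \<beta>: "Suc (num_cycles A (transpose a b \<circ> \<beta>)) = num_cycles A \<beta>"
    by (rule num_cycles_left_join[OF assms(1) perm(1) assms(4-6)])
  have l: "linked \<sigma> (transpose a b \<circ> \<beta>) = merge (linked \<sigma> \<beta>) a b"
    by (rule linked_transpose_left[OF perm(1) assms(6)])
  show ?thesis
  proof (cases "linked \<sigma> \<beta> a b")
    case True
    then show ?thesis
      using \<beta> num_cycles_transpose_le[OF assms(1) perm(2) assms(4,5)]
      unfolding defect_def inv l merge_same[OF equivp_linked True] by linarith
  next
    case False
    \<comment> \<open>Cycles of the product lie inside the classes of the generated group, so
      unlinked points are on different cycles of the product.\<close>
    have "same_cycle (\<sigma> \<circ> inv' \<beta>) x y \<Longrightarrow> linked \<sigma> \<beta> x y" for x y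
    proof (rule linked_mono[where \<sigma> = "\<lambda>x. x" and \<beta> = "\<sigma> \<circ> inv' \<beta>", rotated 2])
      show "linked \<sigma> \<beta> x ((\<sigma> \<circ> inv' \<beta>) x)" for x
        using linked_right[of \<sigma> \<beta> "inv' \<beta> x"] linked_left[of \<sigma> \<beta> "inv' \<beta> x"]
        by (simp add: permutes_inverses[OF assms(3)]) (meson linked_sym linked_trans)
    qed auto
    with False have "\<not> same_cycle (\<sigma> \<circ> inv' \<beta>) a b" by blast
    from num_cycles_join[OF assms(1) perm(2) assms(4,5) this]
      num_classes_merge[OF assms(1) equivp_linked assms(4,5) False] \<beta>
    show ?thesis unfolding defect_def inv l by linarith
  qed
qed

text \<open>The last hypothesis is equality in \<open>num_cycles_comp_le\<close>. It makes every
  transposition of \<gamma>, when passed over to \<beta>, join two cycles, so that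
  \<open>defect_join_mono\<close> applies at each stage.\<close>

lemma defect_mono:
  assumes "finite A" "\<gamma> permutes A" "\<sigma> permutes A" "\<beta> permutes A"
    and "num_cycles A \<beta> + num_cycles A \<gamma> = card A + num_cycles A (\<gamma> \<circ> \<beta>)"
  shows "defect A \<sigma> \<beta> \<le> defect A \<sigma> (\<gamma> \<circ> \<beta>)"
  using assms
proof (induction \<gamma> arbitrary: \<beta> rule: permutes_transpose_induct)
  case (transpose \<gamma> x y)
  have perm: "permutation \<beta>" "permutation \<gamma>"
    using assms(1) transpose by (auto simp: permutation_permutes)
  let ?\<beta> = "transpose x y \<circ> \<beta>"
  have \<beta>: "?\<beta> permutes A"
    by (rule permutes_transpose_comp[OF transpose.prems(2) transpose.hyps(2,3)])
  have \<gamma>: "Suc (num_cycles A (\<gamma> \<circ> transpose x y)) = num_cycles A \<gamma>"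
    by (rule num_cycles_join[OF assms(1) perm(2) transpose.hyps(2-4)])
  have le: "num_cycles A ?\<beta> + num_cycles A \<gamma> \<le> card A + num_cycles A (\<gamma> \<circ> ?\<beta>)"
    by (rule num_cycles_comp_le[OF assms(1) transpose.hyps(1) \<beta>])
  have eq: "num_cycles A (\<gamma> \<circ> transpose x y \<circ> \<beta>) = num_cycles A (\<gamma> \<circ> ?\<beta>)"
    by (simp add: comp_assoc)
  \<comment> \<open>Otherwise \<beta> would not lose a cycle while \<gamma> gains one, and the
    inequality \<open>le\<close> would fail.\<close>
  have ns: "\<not> same_cycle \<beta> x y"
  proof
    assume "same_cycle \<beta> x y"
    from num_cycles_left_not_join[OF assms(1) perm(1) transpose.hyps(2,3) this]
    show False using \<gamma> le transpose.prems(3) unfolding eq by linarith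
  qed
  have "defect A \<sigma> \<beta> \<le> defect A \<sigma> ?\<beta>"
    by (rule defect_join_mono[OF assms(1,3) transpose.prems(2) transpose.hyps(2,3) ns])
  \<comment> \<open>The cycle lost by \<beta> is balanced by the one gained by \<gamma>, so the
    equality persists for the induction hypothesis.\<close>
  also have "\<dots> \<le> defect A \<sigma> (\<gamma> \<circ> ?\<beta>)"
    using num_cycles_left_join[OF assms(1) perm(1) transpose.hyps(2,3) ns] \<gamma> transpose.prems(3)
    unfolding eq by (intro transpose.IH[OF transpose.prems(1) \<beta>]) linarith
  finally show ?case by (simp add: comp_def)
qed simp

text \<open>Here \<open>defect_mono\<close> starts from the identity, where its cycle equality is
  trivial and the components are the cycles of \<sigma>.\<close>

lemma defect_nonneg:
  assumes "finite A" "\<sigma> permutes A" "\<beta> permutes A"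
  shows "0 \<le> defect A \<sigma> \<beta>"
proof -
  have "linked \<sigma> id = same_cycle \<sigma>"
    by (intro ext iffI; rule linked_mono) (auto intro: linked_left linked_right)
  moreover have "permutation \<sigma>" using assms by (auto simp: permutation_permutes)
  ultimately have "defect A \<sigma> id = 0"
    by (simp add: defect_def num_cycles_id[OF assms(1)] num_cycles_eq_num_classes)
  moreover have "defect A \<sigma> id \<le> defect A \<sigma> (\<beta> \<circ> id)"
    using assms by (intro defect_mono) (auto simp: permutes_id num_cycles_id)
  ultimately show ?thesis by simp
qed

section \<open>Noncrossing chords\<close>

text \<open>The values of \<tau> outside \<open>X\<close> are left open; products are therefore
  formed with \<open>perm_restrict \<tau> X\<close>, a product of disjoint transpositions for finite
  \<open>X\<close>.\<close>

definition pairing :: "('a \<Rightarrow> 'a) \<Rightarrow> 'a set \<Rightarrow> bool" where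
  "pairing \<tau> X \<longleftrightarrow> (\<forall>x\<in>X. \<tau> x \<in> X \<and> \<tau> (\<tau> x) = x \<and> \<tau> x \<noteq> x)"

lemma pairing_remove: "pairing \<tau> X \<Longrightarrow> x \<in> X \<Longrightarrow> pairing \<tau> (X - {x, \<tau> x})"
  unfolding pairing_def by (metis Diff_iff insert_iff singletonD)

lemma pairing_induct [consumes 2, case_names empty insert]:
  assumes "finite X" "pairing \<tau> X" "P {}"
    and step: "\<And>X x. finite X \<Longrightarrow> pairing \<tau> X \<Longrightarrow> x \<notin> X \<Longrightarrow> \<tau> x \<notin> X \<Longrightarrow> \<tau> x \<noteq> x \<Longrightarrow> \<tau> (\<tau> x) = x
      \<Longrightarrow> P X \<Longrightarrow> P (insert x (insert (\<tau> x) X))"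
  shows "P X"
  using assms(1,2)
proof (induction X rule: finite_psubset_induct)
  case (psubset X)
  show ?case
  proof (cases "X = {}")
    case False
    then obtain x where x: "x \<in> X" by blast
    let ?Y = "X - {x, \<tau> x}"
    have X: "X = insert x (insert (\<tau> x) ?Y)" "\<tau> x \<noteq> x" "\<tau> (\<tau> x) = x"
      using x psubset.prems by (auto simp: pairing_def)
    have "P (insert x (insert (\<tau> x) ?Y))"
      using psubset.hyps x X pairing_remove[OF psubset.prems x]
      by (intro step psubset.IH) auto
    then show ?thesis using X(1) by simp
  qed (simp add: assms(3))
qed

lemma perm_restrict_insert_pair:
  assumes "x \<notin> X" "\<tau> x \<notin> X" "\<tau> (\<tau> x) = x" "pairing \<tau> X"
  shows "perm_restrict \<tau> (insert x (insert (\<tau> x) X)) = transpose x (\<tau> x) \<circ> perm_restrict \<tau> X"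
proof
  fix y
  have "\<tau> y \<noteq> x \<and> \<tau> y \<noteq> \<tau> x" if "y \<in> X"
    using assms that by (metis pairing_def)
  then show "perm_restrict \<tau> (insert x (insert (\<tau> x) X)) y = (transpose x (\<tau> x) \<circ> perm_restrict \<tau> X) y"
    using assms by (auto simp: perm_restrict_def transpose_def)
qed

lemma perm_restrict_empty: "perm_restrict \<tau> {} = id"
  by (simp add: perm_restrict_def fun_eq_iff)

text \<open>Each of the \<open>card X / 2\<close> transpositions adds at most one cycle. Doubling
  avoids the division.\<close>

lemma num_cycles_pairing_le:
  assumes "finite X" "pairing \<tau> X" "finite A" "\<zeta> permutes A" "X \<subseteq> A"
  shows "2 * num_cycles A (\<zeta> \<circ> perm_restrict \<tau> X) \<le> 2 * num_cycles A \<zeta> + card X"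
  using assms
proof (induction X arbitrary: \<zeta> rule: pairing_induct)
  case (insert X x)
  have \<zeta>': "\<zeta> \<circ> transpose x (\<tau> x) permutes A"
    using insert.prems by (intro permutes_compose permutes_swap_id) auto
  have "2 * num_cycles A ((\<zeta> \<circ> transpose x (\<tau> x)) \<circ> perm_restrict \<tau> X)
      \<le> 2 * num_cycles A (\<zeta> \<circ> transpose x (\<tau> x)) + card X"
    using insert.prems by (intro insert.IH \<zeta>') auto
  moreover have "num_cycles A (\<zeta> \<circ> transpose x (\<tau> x)) \<le> Suc (num_cycles A \<zeta>)"
    using insert.prems by (intro num_cycles_transpose_le) (auto simp: permutation_permutes)
  moreover have "card (insert x (insert (\<tau> x) X)) = card X + 2"
    using insert.hyps by simp
  ultimately show ?case
    unfolding perm_restrict_insert_pair[OF insert.hyps(3,4,6,2)] comp_assoc by linarith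
qed (simp add: perm_restrict_empty)

text \<open>Splitting a cycle along one chord separates its two arcs; another chord does not cross
  it when its ends stay together.\<close>

definition chords_noncrossing :: "('a \<Rightarrow> 'a) \<Rightarrow> ('a \<Rightarrow> 'a) \<Rightarrow> 'a set \<Rightarrow> bool" where
  "chords_noncrossing \<zeta> \<tau> X \<longleftrightarrow>
     (\<forall>x\<in>X. \<forall>y\<in>X. y \<noteq> x \<longrightarrow> y \<noteq> \<tau> x \<longrightarrow> same_cycle (\<zeta> \<circ> transpose x (\<tau> x)) y (\<tau> y))"

text \<open>
  Pairwise noncrossing chords stay pairwise noncrossing after one of them has split its cycle.
  Suppose the product separates \<open>c\<close> from \<open>c'\<close>. Omitting either transposition merges two of its
  classes and joins \<open>c\<close> to \<open>c'\<close>, so these are the classes of \<open>b, b'\<close> as well as those of \<open>a, a'\<close>.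
  Then \<open>a\<close> and \<open>a'\<close> lie in one cycle of \<open>\<zeta> \<circ> transpose a a'\<close>, which is impossible.
\<close>

lemma same_cycle_three_chords:
  assumes \<zeta>: "permutation \<zeta>" and ne: "a \<noteq> a'" "b \<noteq> b'" "{a, a'} \<inter> {b, b'} = {}"
    and a: "same_cycle \<zeta> a a'" "same_cycle (\<zeta> \<circ> transpose b b') a a'"
    and b: "same_cycle (\<zeta> \<circ> transpose a a') b b'"
    and c: "same_cycle (\<zeta> \<circ> transpose a a') c c'" "same_cycle (\<zeta> \<circ> transpose b b') c c'"
  shows "same_cycle (\<zeta> \<circ> transpose a a' \<circ> transpose b b') c c'"
proof (rule ccontr)
  let ?E = "same_cycle (\<zeta> \<circ> transpose a a' \<circ> transpose b b')"
  assume nc: "\<not> ?E c c'"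
  have com: "\<zeta> \<circ> transpose b b' \<circ> transpose a a' = \<zeta> \<circ> transpose a a' \<circ> transpose b b'"
    using ne by (auto simp: fun_eq_iff transpose_def)
  have ma: "same_cycle (\<zeta> \<circ> transpose a a') = merge ?E b b'"
    by (rule same_cycle_unsplit[OF permutation_transpose_comp(1)[OF \<zeta>] b ne(2)])
  have mb: "same_cycle (\<zeta> \<circ> transpose b b') = merge ?E a a'"
    using same_cycle_unsplit[OF permutation_transpose_comp(1)[OF \<zeta>] a(2) ne(1)] unfolding com .
  have "\<not> merge ?E b b' a a'"
    using same_cycle_split[OF \<zeta> a(1) ne(1)] unfolding ma .
  moreover have "merge ?E b b' c c'" "merge ?E a a' c c'"
    using c unfolding ma mb by simp_all
  ultimately show False
    using nc unfolding merge_def by (meson linked_sym linked_trans)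
qed

text \<open>The chord split off first adds one cycle. Each remaining chord still lies in one cycle,
  and by \<open>same_cycle_three_chords\<close> they remain noncrossing, so the induction
  continues.\<close>

lemma num_cycles_noncrossing:
  assumes "finite X" "pairing \<tau> X" "finite A" "\<zeta> permutes A" "X \<subseteq> A"
    and "\<forall>x\<in>X. same_cycle \<zeta> x (\<tau> x)" "chords_noncrossing \<zeta> \<tau> X"
  shows "2 * num_cycles A (\<zeta> \<circ> perm_restrict \<tau> X) = 2 * num_cycles A \<zeta> + card X"
  using assms
proof (induction X arbitrary: \<zeta> rule: pairing_induct)
  case (insert X x)
  let ?\<zeta> = "\<zeta> \<circ> transpose x (\<tau> x)"
  have \<zeta>': "?\<zeta> permutes A"
    using insert.prems by (intro permutes_compose permutes_swap_id) auto
  have perm: "permutation \<zeta>" using insert.prems by (auto simp: permutation_permutes)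
  have nc: "same_cycle (\<zeta> \<circ> transpose u (\<tau> u)) v (\<tau> v)"
    if "u \<in> insert x X" "v \<in> insert x X" "v \<noteq> u" "v \<noteq> \<tau> u" for u v
    using insert.prems(5) that unfolding chords_noncrossing_def by blast
  have tau: "\<tau> u \<in> X" "\<tau> (\<tau> u) = u" "\<tau> u \<noteq> u" if "u \<in> X" for u
    using insert.hyps(2) that by (auto simp: pairing_def)
  have ne: "u \<noteq> x" "u \<noteq> \<tau> x" "\<tau> u \<noteq> x" "\<tau> u \<noteq> \<tau> x" if "u \<in> X" for u
    using insert.hyps(3,4,6) tau[OF that] that by metis+
  have "2 * num_cycles A (?\<zeta> \<circ> perm_restrict \<tau> X) = 2 * num_cycles A ?\<zeta> + card X"
  proof (rule insert.IH[OF insert.prems(1) \<zeta>'])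
    show "X \<subseteq> A" using insert.prems by auto
    show "\<forall>y\<in>X. same_cycle ?\<zeta> y (\<tau> y)"
      using ne by (intro ballI nc) auto
    show "chords_noncrossing ?\<zeta> \<tau> X"
      unfolding chords_noncrossing_def
    proof (intro ballI impI)
      fix u v assume uv: "u \<in> X" "v \<in> X" "v \<noteq> u" "v \<noteq> \<tau> u"
      show "same_cycle (?\<zeta> \<circ> transpose u (\<tau> u)) v (\<tau> v)"
      proof (rule same_cycle_three_chords[OF perm])
        show "same_cycle \<zeta> x (\<tau> x)" using insert.prems by blast
        show "same_cycle (\<zeta> \<circ> transpose u (\<tau> u)) x (\<tau> x)"
          using uv ne[OF uv(1)] by (intro nc) auto
        show "u \<noteq> \<tau> u" "{x, \<tau> x} \<inter> {u, \<tau> u} = {}" "x \<noteq> \<tau> x"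
          using tau(3)[OF uv(1)] ne[OF uv(1)] insert.hyps(5) by auto
      qed (use uv ne[OF uv(1)] ne[OF uv(2)] in \<open>auto intro!: nc\<close>)
    qed
  qed
  moreover have "num_cycles A ?\<zeta> = Suc (num_cycles A \<zeta>)"
    using insert.prems insert.hyps perm by (intro num_cycles_split) auto
  moreover have "card (insert x (insert (\<tau> x) X)) = card X + 2"
    using insert.hyps by simp
  ultimately show ?case
    unfolding perm_restrict_insert_pair[OF insert.hyps(3,4,6,2)] comp_assoc by linarith
qed (simp add: perm_restrict_empty)

text \<open>Multiplying by the two crossing chords first gains nothing: the second joins what the
  first may have split. The remaining chords cannot make up for this.\<close>

lemma num_cycles_crossing:
  assumes "pairing \<tau> X" "finite A" "\<zeta> permutes A" "X \<subseteq> A"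
    and "\<forall>x\<in>X. same_cycle \<zeta> x (\<tau> x)" "\<not> chords_noncrossing \<zeta> \<tau> X"
  shows "2 * num_cycles A (\<zeta> \<circ> perm_restrict \<tau> X) < 2 * num_cycles A \<zeta> + card X"
proof -
  from assms(6) obtain x y where xy: "x \<in> X" "y \<in> X" "y \<noteq> x" "y \<noteq> \<tau> x"
    and ns: "\<not> same_cycle (\<zeta> \<circ> transpose x (\<tau> x)) y (\<tau> y)"
    unfolding chords_noncrossing_def by blast
  have tau: "\<tau> u \<in> X" "\<tau> (\<tau> u) = u" "\<tau> u \<noteq> u" if "u \<in> X" for u
    using assms(1) that by (auto simp: pairing_def)
  have fin: "finite X" using assms finite_subset by blast
  let ?Y = "X - {x, \<tau> x}" and ?Z = "X - {x, \<tau> x} - {y, \<tau> y}"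
  have Y: "pairing \<tau> ?Y" by (rule pairing_remove[OF assms(1) xy(1)])
  have yY: "y \<in> ?Y" "\<tau> y \<in> ?Y" using xy tau by auto metis
  have Z: "pairing \<tau> ?Z" by (rule pairing_remove[OF Y yY(1)])
  have X_eq: "X = insert x (insert (\<tau> x) ?Y)" and Y_eq: "?Y = insert y (insert (\<tau> y) ?Z)"
    using xy tau yY by auto
  \<comment> \<open>The transpositions are disjoint, so the crossing pair can be taken out
    first.\<close>
  have "perm_restrict \<tau> X = transpose x (\<tau> x) \<circ> perm_restrict \<tau> ?Y"
    by (subst X_eq, rule perm_restrict_insert_pair) (use tau xy Y in auto)
  moreover have "perm_restrict \<tau> ?Y = transpose y (\<tau> y) \<circ> perm_restrict \<tau> ?Z"
    by (subst Y_eq, rule perm_restrict_insert_pair) (use tau xy Z in auto)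
  ultimately have eq: "\<zeta> \<circ> perm_restrict \<tau> X
      = \<zeta> \<circ> transpose x (\<tau> x) \<circ> transpose y (\<tau> y) \<circ> perm_restrict \<tau> ?Z"
    by (simp add: comp_assoc)
  have A: "x \<in> A" "\<tau> x \<in> A" "y \<in> A" "\<tau> y \<in> A" using xy tau assms(4) by auto
  have perm: "permutation \<zeta>" using assms by (auto simp: permutation_permutes)
  have "2 * num_cycles A (\<zeta> \<circ> perm_restrict \<tau> X)
      \<le> 2 * num_cycles A (\<zeta> \<circ> transpose x (\<tau> x) \<circ> transpose y (\<tau> y)) + card ?Z"
    unfolding eq using fin assms A Z
    by (intro num_cycles_pairing_le permutes_compose permutes_swap_id) auto
  moreover have "Suc (num_cycles A (\<zeta> \<circ> transpose x (\<tau> x) \<circ> transpose y (\<tau> y)))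
      = num_cycles A (\<zeta> \<circ> transpose x (\<tau> x))"
    by (rule num_cycles_join[OF assms(2) permutation_transpose_comp(1)[OF perm] A(3,4) ns])
  moreover have "num_cycles A (\<zeta> \<circ> transpose x (\<tau> x)) \<le> Suc (num_cycles A \<zeta>)"
    by (rule num_cycles_transpose_le(1)[OF assms(2) perm A(1,2)])
  moreover have "card ?Z < card X"
    using fin xy by (intro psubset_card_mono) auto
  ultimately show ?thesis by linarith
qed

lemma num_cycles_noncrossing_iff:
  assumes "pairing \<tau> X" "finite A" "\<zeta> permutes A" "X \<subseteq> A" "\<forall>x\<in>X. same_cycle \<zeta> x (\<tau> x)"
  shows "2 * num_cycles A (\<zeta> \<circ> perm_restrict \<tau> X) = 2 * num_cycles A \<zeta> + card X
    \<longleftrightarrow> chords_noncrossing \<zeta> \<tau> X"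
  using num_cycles_noncrossing[OF finite_subset[OF assms(4,2)] assms(1-5)]
    num_cycles_crossing[OF assms] by (metis less_irrefl)

text \<open>Multiplying by the transposition of \<open>a\<close> and \<open>c\<close> separates the two arcs between them.\<close>

lemma cyclically_ordered_iff:
  assumes "permutation \<zeta>" "b \<in> Orbits.orbit \<zeta> a" "c \<in> Orbits.orbit \<zeta> a" "d \<in> Orbits.orbit \<zeta> a"
    "a \<noteq> c" "b \<noteq> c" "d \<noteq> a"
  shows "cyclically_ordered \<zeta> a b c d \<longleftrightarrow>
    same_cycle (\<zeta> \<circ> transpose a c) c b \<and> \<not> same_cycle (\<zeta> \<circ> transpose a c) c d"
proof -
  have ac: "same_cycle \<zeta> a c" using assms by (simp add: orbit_eq_same_cycle)
  have eq: "same_cycle (\<zeta> \<circ> transpose a c) c x \<longleftrightarrow>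
      0 < funpow_dist \<zeta> a x \<and> funpow_dist \<zeta> a x \<le> funpow_dist \<zeta> a c"
    if "x \<in> Orbits.orbit \<zeta> a" for x
    using orbit_transpose[OF assms(1) ac assms(5)] that
      orbit_eq_same_cycle[OF permutation_transpose_comp(1)[OF assms(1)], of a c c] by auto
  have "funpow_dist \<zeta> a b \<noteq> funpow_dist \<zeta> a c"
    using funpow_dist_prop[OF assms(2)] funpow_dist_prop[OF assms(3)] assms(6) by metis
  moreover have "funpow_dist \<zeta> a d \<noteq> 0"
    using funpow_dist_0_eq[OF assms(4)] assms(7) by simp
  ultimately show ?thesis
    unfolding cyclically_ordered_def eq[OF assms(2)] eq[OF assms(4)] using assms by auto
qed

section \<open>The medial map\<close>

lemma noncrossingD:
  assumes "noncrossing f P" "B \<in> P" "C \<in> P" "B \<noteq> C" "a \<in> B" "b \<in> C" "c \<in> B" "d \<in> C"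
  shows "\<not> cyclically_ordered f a b c d"
  using assms unfolding noncrossing_def by meson

text \<open>Both conditions say that no chord has its ends on different arcs of another;
  \<open>cyclically_ordered_iff\<close> translates positions along a cycle into cycles after a
  split.\<close>

lemma noncrossing_iff_chords_noncrossing:
  assumes "finite A" "\<zeta> permutes A" "pairing \<tau> A" "\<forall>x\<in>A. same_cycle \<zeta> x (\<tau> x)"
  shows "noncrossing \<zeta> ((\<lambda>x. {x, \<tau> x}) ` A) \<longleftrightarrow> chords_noncrossing \<zeta> \<tau> A"
proof
  have perm: "permutation \<zeta>" using assms by (auto simp: permutation_permutes)
  have tau: "\<tau> u \<in> A" "\<tau> (\<tau> u) = u" "\<tau> u \<noteq> u" if "u \<in> A" for u
    using assms(3) that by (auto simp: pairing_def)
  assume nc: "noncrossing \<zeta> ((\<lambda>x. {x, \<tau> x}) ` A)"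
  show "chords_noncrossing \<zeta> \<tau> A"
    unfolding chords_noncrossing_def
  proof (intro ballI impI, rule ccontr)
    fix x y assume xy: "x \<in> A" "y \<in> A" "y \<noteq> x" "y \<noteq> \<tau> x"
    define E where "E = same_cycle (\<zeta> \<circ> transpose x (\<tau> x))"
    assume "\<not> same_cycle (\<zeta> \<circ> transpose x (\<tau> x)) y (\<tau> y)"
    then have ns: "\<not> E y (\<tau> y)" by (simp only: E_def not_False_eq_True)
    have x: "same_cycle \<zeta> x (\<tau> x)" "x \<noteq> \<tau> x" using assms(4) xy tau(3)[OF xy(1)] by auto
    have E_sym: "E u v \<Longrightarrow> E v u" and E_trans: "E u v \<Longrightarrow> E v w \<Longrightarrow> E u w" for u v w
      unfolding E_def by (erule linked_sym, erule (1) linked_trans)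
    have m: "same_cycle \<zeta> = merge E x (\<tau> x)"
      unfolding E_def by (rule same_cycle_unsplit[OF perm x])
    have nx: "\<not> E x (\<tau> x)"
      unfolding E_def by (rule same_cycle_split[OF perm x])
    have "merge E x (\<tau> x) y (\<tau> y)" using assms(4) xy(2) unfolding m by blast
    \<comment> \<open>The ends are together before the split and apart after it, so one lies on the
      piece of \<open>\<tau> x\<close> and the other on the piece of \<open>x\<close>.\<close>
    then have "\<exists>b d. {b, d} = {y, \<tau> y} \<and> E (\<tau> x) b \<and> E x d"
      using ns unfolding merge_def by (metis E_sym insert_commute)
    then obtain b d where bd: "{b, d} = {y, \<tau> y}" "E (\<tau> x) b" "E x d" by blast
    have "\<tau> y \<noteq> x" "\<tau> y \<noteq> \<tau> x" using xy tau by metis+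
    then have ne: "b \<noteq> x" "b \<noteq> \<tau> x" "d \<noteq> x" "d \<noteq> \<tau> x"
      using bd(1) xy(3,4) by (auto simp: doubleton_eq_iff)
    have orb: "Orbits.orbit \<zeta> x = Collect (merge E x (\<tau> x) x)"
      unfolding m[symmetric] by (rule orbit_eq_same_cycle[OF perm])
    have "E x x" unfolding E_def by (rule linked_refl)
    then have "b \<in> Orbits.orbit \<zeta> x" "\<tau> x \<in> Orbits.orbit \<zeta> x" "d \<in> Orbits.orbit \<zeta> x"
      using bd x(1) unfolding orb by (auto simp: merge_def m)
    moreover have "\<not> E (\<tau> x) d" using bd(3) nx E_sym E_trans by blast
    ultimately have "cyclically_ordered \<zeta> x b (\<tau> x) d"
      using cyclically_ordered_iff[OF perm, of b x "\<tau> x" d] x ne bd(2) unfolding E_def by blast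
    moreover have "{x, \<tau> x} \<noteq> {y, \<tau> y}" using xy by (auto simp: doubleton_eq_iff)
    moreover have "b \<in> {y, \<tau> y}" "d \<in> {y, \<tau> y}" using bd(1) by auto
    moreover have "\<tau> x \<in> {x, \<tau> x}" "x \<in> {x, \<tau> x}" by simp_all
    ultimately show False
      using noncrossingD[OF nc imageI[OF xy(1)] imageI[OF xy(2)]] by metis
  qed
next
  have perm: "permutation \<zeta>" using assms by (auto simp: permutation_permutes)
  have tau: "\<tau> u \<in> A" "\<tau> (\<tau> u) = u" "\<tau> u \<noteq> u" if "u \<in> A" for u
    using assms(3) that by (auto simp: pairing_def)
  have pair: "v = \<tau> u" "X = {u, \<tau> u}" "u \<in> A"
    if X: "X \<in> (\<lambda>x. {x, \<tau> x}) ` A" "u \<in> X" "v \<in> X" "u \<noteq> v" for u v X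
  proof -
    from X(1) obtain w where w: "w \<in> A" "X = {w, \<tau> w}" by blast
    consider "u = w" "v = \<tau> w" | "u = \<tau> w" "v = w" using X(2-4) w(2) by blast
    then have "v = \<tau> u \<and> X = {u, \<tau> u} \<and> u \<in> A"
      using tau[OF w(1)] w by cases (simp_all add: insert_commute)
    then show "v = \<tau> u" "X = {u, \<tau> u}" "u \<in> A" by blast+
  qed
  assume nc: "chords_noncrossing \<zeta> \<tau> A"
  show "noncrossing \<zeta> ((\<lambda>x. {x, \<tau> x}) ` A)"
    unfolding noncrossing_def
  proof (intro ballI impI notI)
    fix B C assume BC: "B \<in> (\<lambda>x. {x, \<tau> x}) ` A" "C \<in> (\<lambda>x. {x, \<tau> x}) ` A" "B \<noteq> C"
    assume "\<exists>a\<in>B. \<exists>b\<in>C. \<exists>c\<in>B. \<exists>d\<in>C. cyclically_ordered \<zeta> a b c d"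
    then obtain a b c d where abcd: "a \<in> B" "b \<in> C" "c \<in> B" "d \<in> C"
      and co: "cyclically_ordered \<zeta> a b c d" by blast
    have ne: "a \<noteq> c" "b \<noteq> d" "d \<noteq> a"
      using co funpow_dist_0[of a a \<zeta>] unfolding cyclically_ordered_def by auto
    \<comment> \<open>Blocks have two elements, so the alternating points satisfy
      \<open>c = \<tau> a\<close> and \<open>d = \<tau> b\<close>.\<close>
    note B = pair[OF BC(1) abcd(1,3) ne(1)] and C = pair[OF BC(2) abcd(2,4) ne(2)]
    have b: "b \<noteq> a" "b \<noteq> c"
      using BC(3) B(1,2) C(2) tau(2)[OF B(3)] by (metis insert_commute)+
    have sc: "same_cycle (\<zeta> \<circ> transpose a c) b d"
      using nc B C b unfolding chords_noncrossing_def by blast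
    have "same_cycle (\<zeta> \<circ> transpose a c) c b \<and> \<not> same_cycle (\<zeta> \<circ> transpose a c) c d"
      using cyclically_ordered_iff[OF perm _ _ _ ne(1) b(2) ne(3)] co
      unfolding cyclically_ordered_def by blast
    then show False using sc linked_trans by fast
  qed
qed

section \<open>Cycles of the vertex permutation and of its product with a matching\<close>

lemma medial_vertex_apply:
  "fst (medial_map n \<sigma> \<alpha>) (Neg i) = (if i \<in> {1..n} then Pos i else Neg i)"
  "fst (medial_map n \<sigma> \<alpha>) (Pos i) = (if i \<in> {1..n} then Neg (\<alpha> i) else Pos i)"
  by (auto simp: medial_map_def perm_restrict_def signed_points_def)

lemma finite_signed_points: "finite (signed_points n)"
  by (simp add: signed_points_def)

lemma card_signed_points: "card (signed_points n) = 2 * n"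
  unfolding signed_points_def
  by (subst card_Un_disjoint) (auto simp: card_image inj_on_def)

lemma signed_points_iff [simp]:
  "Neg i \<in> signed_points n \<longleftrightarrow> i \<in> {1..n}" "Pos i \<in> signed_points n \<longleftrightarrow> i \<in> {1..n}"
  by (auto simp: signed_points_def)

lemma medial_vertex_permutes:
  assumes "\<alpha> permutes {1..n}"
  shows "fst (medial_map n \<sigma> \<alpha>) permutes signed_points n"
proof (rule inj_imp_permutes)
  note app = medial_vertex_apply[of n \<sigma> \<alpha>]
  have \<alpha>: "\<alpha> i \<in> {1..n} \<longleftrightarrow> i \<in> {1..n}" for i
    by (rule permutes_in_image[OF assms])
  show "inj_on (fst (medial_map n \<sigma> \<alpha>)) (signed_points n)"
  proof (rule inj_onI)
    fix p q assume "p \<in> signed_points n" "q \<in> signed_points n"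
      "fst (medial_map n \<sigma> \<alpha>) p = fst (medial_map n \<sigma> \<alpha>) q"
    then show "p = q"
      using permutes_inj[OF assms]
      by (cases p; cases q) (auto simp: app dest: injD split: if_splits)
  qed
  show "fst (medial_map n \<sigma> \<alpha>) p \<in> signed_points n" if "p \<in> signed_points n" for p
    using that \<alpha> by (cases p) (auto simp: app)
  show "fst (medial_map n \<sigma> \<alpha>) p = p" if "p \<notin> signed_points n" for p
    using that by (cases p) (auto simp: app)
qed (rule finite_signed_points)

fun base_point :: "signed_point \<Rightarrow> nat" where
  "base_point (Neg i) = i"
| "base_point (Pos i) = i"

text \<open>A step of \<alpha> lifts to two vertex steps through \<open>Neg i\<close>,
  \<open>Pos i\<close>, \<open>Neg (\<alpha> i)\<close>; conversely a vertex step projects to no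
  move or to one step of \<alpha>.\<close>

lemma same_cycle_medial_vertex_iff:
  assumes "\<alpha> permutes {1..n}" "p \<in> signed_points n" "q \<in> signed_points n"
  shows "same_cycle (fst (medial_map n \<sigma> \<alpha>)) p q \<longleftrightarrow> same_cycle \<alpha> (base_point p) (base_point q)"
proof -
  define \<zeta> where "\<zeta> = fst (medial_map n \<sigma> \<alpha>)"
  note app = medial_vertex_apply[of n \<sigma> \<alpha>, folded \<zeta>_def]
  have \<alpha>_id: "i \<notin> {1..n} \<Longrightarrow> \<alpha> i = i" for i
    using assms(1) by (simp add: permutes_not_in)
  have NP: "same_cycle \<zeta> (Neg i) (Pos i)" if "i \<in> {1..n}" for i
    using linked_right[of "\<lambda>x. x" \<zeta> "Neg i"] that by (simp add: app)
  have "same_cycle \<zeta> (Neg i) (Neg (\<alpha> i))" for i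
  proof (cases "i \<in> {1..n}")
    case True
    have "same_cycle \<zeta> (Pos i) (Neg (\<alpha> i))"
      using linked_right[of "\<lambda>x. x" \<zeta> "Pos i"] True by (simp add: app)
    with NP[OF True] show ?thesis by (rule linked_trans)
  qed (simp add: \<alpha>_id)
  moreover have "equivp (\<lambda>i j. same_cycle \<zeta> (Neg i) (Neg j))"
    by (intro equivpI reflpI sympI transpI) (auto intro: linked_sym linked_trans)
  ultimately have 1: "same_cycle \<zeta> (Neg i) (Neg j)" if "same_cycle \<alpha> i j" for i j
    using linked_least[where \<sigma> = "\<lambda>x. x" and \<beta> = \<alpha> and E = "\<lambda>i j. same_cycle \<zeta> (Neg i) (Neg j)"]
      that by blast
  have "same_cycle \<alpha> (base_point p) (base_point (\<zeta> p))" for p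
    by (cases p) (auto simp: app intro: linked_right)
  moreover have "equivp (\<lambda>p q. same_cycle \<alpha> (base_point p) (base_point q))"
    by (intro equivpI reflpI sympI transpI) (auto intro: linked_sym linked_trans)
  ultimately have 2: "same_cycle \<alpha> (base_point p) (base_point q)" if "same_cycle \<zeta> p q" for p q
    using linked_least[where \<sigma> = "\<lambda>x. x" and \<beta> = \<zeta>
        and E = "\<lambda>p q. same_cycle \<alpha> (base_point p) (base_point q)"] that by blast
  have 3: "same_cycle \<zeta> (Neg (base_point p)) p" if "p \<in> signed_points n" for p
    using that NP by (cases p) auto
  show ?thesis
    using 1 2 3[OF assms(2)] 3[OF assms(3)] unfolding \<zeta>_def[symmetric]
    by (meson linked_sym linked_trans)
qed

lemma base_point_image: "base_point ` signed_points n = {1..n}"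
  by (force simp: signed_points_def image_Un image_image)

lemma num_cycles_medial_vertex:
  assumes "\<alpha> permutes {1..n}"
  shows "num_cycles (signed_points n) (fst (medial_map n \<sigma> \<alpha>)) = num_cycles {1..n} \<alpha>"
proof -
  have "permutation \<alpha>" "permutation (fst (medial_map n \<sigma> \<alpha>))"
    using assms medial_vertex_permutes[OF assms] finite_signed_points
    by (auto simp: permutation_permutes)
  moreover have "num_classes {1..n} (same_cycle \<alpha>)
      = num_classes (signed_points n) (same_cycle (fst (medial_map n \<sigma> \<alpha>)))"
    by (rule num_classes_image[OF base_point_image equivp_linked equivp_linked])
      (simp only: same_cycle_medial_vertex_iff[OF assms])
  ultimately show ?thesis by (simp add: num_cycles_eq_num_classes)
qed

text \<open>This is the involution of the matching given by \<beta>. With the inverse on negative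
  points, closed paths become cycles of \<open>\<sigma> \<circ> inv' \<beta>\<close>.\<close>

fun matched_point :: "(nat \<Rightarrow> nat) \<Rightarrow> signed_point \<Rightarrow> signed_point" where
  "matched_point \<beta> (Neg i) = Pos (inv' \<beta> i)"
| "matched_point \<beta> (Pos i) = Neg (\<beta> i)"

lemma pairing_matched_point:
  assumes "\<beta> permutes {1..n}"
  shows "pairing (matched_point \<beta>) (signed_points n)"
  unfolding pairing_def
proof
  fix p assume "p \<in> signed_points n"
  then show "matched_point \<beta> p \<in> signed_points n \<and> matched_point \<beta> (matched_point \<beta> p) = p
      \<and> matched_point \<beta> p \<noteq> p"
    using permutes_in_image[OF assms] permutes_in_image[OF permutes_inv[OF assms]]
    by (cases p) (simp_all add: permutes_inverses[OF assms])
qed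

lemma num_cycles_constructor_image:
  assumes "inj F" "g permutes N" "finite N" "\<And>i. \<rho> (F i) = F (g i)"
  shows "num_cycles (F ` N) \<rho> = num_cycles N g"
proof -
  have "Orbits.orbit \<rho> (F i) = F ` Orbits.orbit g i" for i
    using assms by (intro orbit_inverse[symmetric] permutation_self_in_orbit)
      (auto simp: permutation_permutes)
  then have "perm_cycles (F ` N) \<rho> = (`) F ` perm_cycles N g"
    by (simp add: perm_cycles_def image_image)
  then show ?thesis
    unfolding num_cycles_def using assms(1) by (simp add: card_image inj_on_def inj_image_eq_iff)
qed

text \<open>The product preserves signs: it acts as \<open>\<alpha> \<circ> inv' \<beta>\<close> on
  negative points and as \<beta> on positive ones.\<close>

lemma num_cycles_medial_matched:
  assumes "\<alpha> permutes {1..n}" "\<beta> permutes {1..n}"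
  shows "num_cycles (signed_points n)
      (fst (medial_map n \<sigma> \<alpha>) \<circ> perm_restrict (matched_point \<beta>) (signed_points n))
    = num_cycles {1..n} \<beta> + num_cycles {1..n} (\<alpha> \<circ> inv' \<beta>)"
proof -
  define \<rho> where "\<rho> = fst (medial_map n \<sigma> \<alpha>) \<circ> perm_restrict (matched_point \<beta>) (signed_points n)"
  note app = medial_vertex_apply[of n \<sigma> \<alpha>]
  have i: "inv' \<beta> i \<in> {1..n} \<longleftrightarrow> i \<in> {1..n}" "\<beta> i \<in> {1..n} \<longleftrightarrow> i \<in> {1..n}" for i
    using assms(2) by (simp_all only: permutes_in_image permutes_inv)
  have id: "i \<notin> {1..n} \<Longrightarrow> \<alpha> (inv' \<beta> i) = i" "i \<notin> {1..n} \<Longrightarrow> \<beta> i = i" for i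
    using permutes_not_in[OF assms(1)] permutes_not_in[OF assms(2)]
      permutes_not_in[OF permutes_inv[OF assms(2)]] by auto
  have \<rho>: "\<rho> (Neg i) = Neg ((\<alpha> \<circ> inv' \<beta>) i)" "\<rho> (Pos i) = Pos (\<beta> i)" for i
    using i[of i] id[of i]
    by (cases "i \<in> {1..n}"; simp add: \<rho>_def perm_restrict_def app del: atLeastAtMost_iff)+
  have "num_cycles (Neg ` {1..n}) \<rho> = num_cycles {1..n} (\<alpha> \<circ> inv' \<beta>)"
    using assms \<rho> by (intro num_cycles_constructor_image permutes_compose permutes_inv)
      (auto simp: inj_on_def)
  moreover have "num_cycles (Pos ` {1..n}) \<rho> = num_cycles {1..n} \<beta>"
    using assms \<rho> by (intro num_cycles_constructor_image) (auto simp: inj_on_def)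
  moreover have "num_cycles (signed_points n) \<rho>
      = num_cycles (Neg ` {1..n}) \<rho> + num_cycles (Pos ` {1..n}) \<rho>"
    unfolding num_cycles_def perm_cycles_def signed_points_def image_Un
  proof (rule card_Un_disjoint)
    have "x \<in> range Neg" if "x \<in> Orbits.orbit \<rho> (Neg i)" for x i
      using that by induction (auto simp: \<rho>)
    moreover have "x \<in> range Pos" if "x \<in> Orbits.orbit \<rho> (Pos i)" for x i
      using that by induction (auto simp: \<rho>)
    ultimately have "Orbits.orbit \<rho> (Neg i) \<noteq> Orbits.orbit \<rho> (Pos j)" for i j
      using orbit.base[of \<rho> "Neg i"] by fastforce
    then show "Orbits.orbit \<rho> ` Neg ` {1..n} \<inter> Orbits.orbit \<rho> ` Pos ` {1..n} = {}"
      by auto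
  qed simp_all
  ultimately show ?thesis unfolding \<rho>_def by simp
qed

text \<open>This is the cycle count criterion \<open>num_cycles_noncrossing_iff\<close> for all
  \<open>2 * n\<close> signed points, with both cycle counts expressed on \<open>{1..n}\<close> and
  the factor 2 cancelled.\<close>

lemma noncrossing_matched_point_iff:
  assumes "\<alpha> permutes {1..n}" "\<beta> permutes {1..n}" "\<forall>i\<in>{1..n}. same_cycle \<alpha> i (\<beta> i)"
  shows "noncrossing (fst (medial_map n \<sigma> \<alpha>)) ((\<lambda>p. {p, matched_point \<beta> p}) ` signed_points n)
    \<longleftrightarrow> num_cycles {1..n} \<beta> + num_cycles {1..n} (\<alpha> \<circ> inv' \<beta>) = n + num_cycles {1..n} \<alpha>"
proof -
  let ?\<zeta> = "fst (medial_map n \<sigma> \<alpha>)" and ?A = "signed_points n"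
  note \<zeta> = medial_vertex_permutes[OF assms(1), of \<sigma>]
    and pairing = pairing_matched_point[OF assms(2)]
  have "same_cycle \<alpha> (inv' \<beta> i) i" if "i \<in> {1..n}" for i
    using assms(3) that permutes_in_image[OF permutes_inv[OF assms(2)]]
      permutes_inverses(1)[OF assms(2), of i] by metis
  then have "same_cycle \<alpha> (base_point p) (base_point (matched_point \<beta> p))" if "p \<in> ?A" for p
    using that assms(3) by (cases p) (auto intro: linked_sym)
  then have sc: "\<forall>p\<in>?A. same_cycle ?\<zeta> p (matched_point \<beta> p)"
    using pairing by (auto simp: same_cycle_medial_vertex_iff[OF assms(1)] pairing_def)
  have "noncrossing ?\<zeta> ((\<lambda>p. {p, matched_point \<beta> p}) ` ?A)
      \<longleftrightarrow> chords_noncrossing ?\<zeta> (matched_point \<beta>) ?A"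
    by (rule noncrossing_iff_chords_noncrossing[OF finite_signed_points \<zeta> pairing sc])
  also have "\<dots> \<longleftrightarrow> 2 * num_cycles ?A (?\<zeta> \<circ> perm_restrict (matched_point \<beta>) ?A)
      = 2 * num_cycles ?A ?\<zeta> + card ?A"
    by (rule num_cycles_noncrossing_iff[OF pairing finite_signed_points \<zeta> subset_refl sc, symmetric])
  finally show ?thesis
    unfolding num_cycles_medial_vertex[OF assms(1)] num_cycles_medial_matched[OF assms(1,2)]
      card_signed_points by auto
qed

section \<open>Components and refinements\<close>

lemma partition_on_classes:
  assumes "equivp E" "\<And>x. x \<in> A \<Longrightarrow> Collect (E x) \<subseteq> A"
  shows "partition_on A ((\<lambda>x. Collect (E x)) ` A)"
proof (rule partition_onI)
  have refl: "E x x" for x using assms(1) by (rule equivp_reflp)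
  show "\<Union> ((\<lambda>x. Collect (E x)) ` A) = A"
    using assms(2) refl by blast
  show "{} \<notin> (\<lambda>x. Collect (E x)) ` A"
    using refl by blast
  show "disjnt p q" if "p \<in> (\<lambda>x. Collect (E x)) ` A" "q \<in> (\<lambda>x. Collect (E x)) ` A" "p \<noteq> q" for p q
  proof -
    from that obtain x y where xy: "p = Collect (E x)" "q = Collect (E y)" by blast
    show ?thesis
      unfolding disjnt_iff
    proof (intro allI notI)
      fix z assume "z \<in> p \<and> z \<in> q"
      then have "Collect (E x) = Collect (E z)" "Collect (E y) = Collect (E z)"
        unfolding Collect_class_eq_iff[OF assms(1)] xy by simp_all
      with that(3) show False unfolding xy by simp
    qed
  qed
qed

lemma orbit_subset_invariant:
  assumes "\<pi> ` C \<subseteq> C" "x \<in> C"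
  shows "Orbits.orbit \<pi> x \<subseteq> C"
proof
  fix y assume "y \<in> Orbits.orbit \<pi> x"
  then show "y \<in> C" by induction (use assms in auto)
qed

text \<open>A cycle starting in an invariant block stays there, so different blocks contribute
  disjoint sets of cycles.\<close>

lemma num_cycles_partition:
  assumes "finite A" "partition_on A Q" "\<And>C. C \<in> Q \<Longrightarrow> \<pi> ` C \<subseteq> C"
  shows "num_cycles A \<pi> = (\<Sum>C\<in>Q. num_cycles C \<pi>)"
proof -
  have "A = \<Union>Q" using assms(2) by (simp add: partition_on_def)
  then have "perm_cycles A \<pi> = (\<Union>C\<in>Q. perm_cycles C \<pi>)"
    unfolding perm_cycles_def by blast
  moreover have "card (\<Union>C\<in>Q. perm_cycles C \<pi>) = (\<Sum>C\<in>Q. card (perm_cycles C \<pi>))"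
  proof (rule card_UN_disjoint)
    show "finite Q" by (rule finite_elements[OF assms(1,2)])
    show "\<forall>C\<in>Q. finite (perm_cycles C \<pi>)"
      using assms(1) \<open>A = \<Union>Q\<close> unfolding perm_cycles_def by (meson Sup_upper finite_imageI finite_subset)
    show "\<forall>C\<in>Q. \<forall>D\<in>Q. C \<noteq> D \<longrightarrow> perm_cycles C \<pi> \<inter> perm_cycles D \<pi> = {}"
    proof (intro ballI impI equals0I)
      fix C D X assume *: "C \<in> Q" "D \<in> Q" "C \<noteq> D" "X \<in> perm_cycles C \<pi> \<inter> perm_cycles D \<pi>"
      then have "X \<subseteq> C" "X \<subseteq> D" "X \<noteq> {}"
        using orbit_subset_invariant[OF assms(3)] orbit_nonempty unfolding perm_cycles_def by fast+
      with * assms(2) show False unfolding partition_on_def disjoint_def by blast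
    qed
  qed
  ultimately show ?thesis unfolding num_cycles_def by simp
qed

lemma card_partition_sum:
  assumes "finite A" "partition_on A Q"
  shows "card A = (\<Sum>C\<in>Q. card C)"
proof -
  have "card (\<Union>Q) = (\<Sum>C\<in>Q. card C)"
    using assms by (intro card_Union_disjoint)
      (auto simp: partition_on_def disjoint_def pairwise_def disjnt_def intro: finite_subset)
  then show ?thesis using assms(2) by (simp add: partition_on_def)
qed

text \<open>Group elements move points within their class, by induction on the generated subgroup.
  Conversely, lying in one orbit is an equivalence that contains both generators.\<close>

lemma components_eq_classes:
  assumes "\<sigma> permutes {1..n}" "\<beta> permutes {1..n}"
  shows "components n \<sigma> \<beta> = (\<lambda>x. Collect (linked \<sigma> \<beta> x)) ` {1..n}"
proof -
  let ?S = "sym_group n" and ?H = "generate (sym_group n) {\<sigma>, \<beta>}"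
  interpret group ?S by (rule sym_group_is_group)
  have H: "{\<sigma>, \<beta>} \<subseteq> carrier ?S" using assms by (simp add: sym_group_carrier)
  have sub: "subgroup ?H ?S" by (rule generate_is_subgroup[OF H])
  have carrier: "carrier (subgroup_generated ?S {\<sigma>, \<beta>}) = ?H"
    using H by (simp add: carrier_subgroup_generated Int_absorb1)
  have 1: "linked \<sigma> \<beta> x (h x)" if "h \<in> ?H" for h x
    using that
  proof (induction arbitrary: x)
    case one
    show ?case by (simp add: sym_group_one)
  next
    case (incl h)
    then show ?case by (auto intro: linked_left linked_right)
  next
    case (inv h)
    then have h: "h permutes {1..n}" using assms by auto
    then have "inv\<^bsub>?S\<^esub> h = inv' h" by (simp add: sym_group_inv_equality sym_group_carrier)
    moreover have "linked \<sigma> \<beta> (inv' h x) (h (inv' h x))"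
      using inv by (auto intro: linked_left linked_right)
    ultimately show ?case using permutes_inverses(1)[OF h] linked_sym by fastforce
  next
    case (eng h1 h2)
    have "linked \<sigma> \<beta> x (h1 (h2 x))" using eng.IH by (metis linked_trans)
    then show ?case by (simp add: sym_group_mult)
  qed
  have 2: "\<exists>h\<in>?H. y = h x" if "linked \<sigma> \<beta> x y" for x y
  proof (rule linked_least[OF _ _ _ that])
    show "equivp (\<lambda>x y. \<exists>h\<in>?H. y = h x)"
    proof (intro equivpI reflpI sympI transpI)
      show "\<exists>h\<in>?H. x = h x" for x
        using generate.one[of ?S "{\<sigma>, \<beta>}"] by (intro bexI[of _ id]) (auto simp: sym_group_one)
      show "\<exists>h\<in>?H. x = h y" if "\<exists>h\<in>?H. y = h x" for x y
      proof -
        from that obtain h where h: "h \<in> ?H" "y = h x" by blast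
        then have hS: "h \<in> carrier ?S" using subgroup.mem_carrier[OF sub] by blast
        then have "inv' h \<in> ?H"
          using subgroup.m_inv_closed[OF sub h(1)] by (simp add: sym_group_inv_equality)
        moreover have "x = inv' h y"
          using h(2) hS by (simp add: sym_group_carrier permutes_inverses)
        ultimately show ?thesis by blast
      qed
      show "\<exists>h\<in>?H. z = h x" if "\<exists>h\<in>?H. y = h x" "\<exists>h\<in>?H. z = h y" for x y z
      proof -
        from that obtain g h where gh: "g \<in> ?H" "h \<in> ?H" "y = g x" "z = h y" by blast
        then have "h \<circ> g \<in> ?H"
          using subgroup.m_closed[OF sub gh(2,1)] by (simp add: sym_group_mult)
        with gh show ?thesis by (intro bexI[of _ "h \<circ> g"]) auto
      qed
    qed
  qed (auto intro: generate.incl)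
  have "Group_Action.orbit (subgroup_generated ?S {\<sigma>, \<beta>}) (\<lambda>g. g) x = Collect (linked \<sigma> \<beta> x)" for x
    unfolding Group_Action.orbit_def carrier by (rule Set.set_eqI) (use 1 2 in blast)
  then show ?thesis
    unfolding components_def Group_Action.orbits_def by auto
qed

lemma num_components_eq:
  assumes "\<sigma> permutes {1..n}" "\<beta> permutes {1..n}"
  shows "num_components n \<sigma> \<beta> = num_classes {1..n} (linked \<sigma> \<beta>)"
  by (simp add: num_components_def num_classes_def components_eq_classes[OF assms])

lemma linked_class_subset:
  assumes "\<sigma> permutes A" "\<beta> permutes A" "x \<in> A"
  shows "Collect (linked \<sigma> \<beta> x) \<subseteq> A"
proof
  fix y assume y: "y \<in> Collect (linked \<sigma> \<beta> x)"
  have "equivp (\<lambda>x y. x \<in> A \<longleftrightarrow> y \<in> A)"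
    by (intro equivpI reflpI sympI transpI) auto
  then have "x \<in> A \<longleftrightarrow> y \<in> A"
    by (rule linked_least[where \<sigma> = \<sigma> and \<beta> = \<beta>])
      (use y permutes_in_image[OF assms(1)] permutes_in_image[OF assms(2)] in auto)
  with assms(3) show "y \<in> A" by simp
qed

text \<open>Summing the genus formula over the components gives the global count, since \<sigma>,
  \<alpha> and their quotient map each component into itself.\<close>

lemma defect_genus_zero:
  assumes "genus_zero_collection n \<sigma> \<alpha>"
  shows "defect {1..n} \<sigma> \<alpha> = 0"
proof -
  have \<sigma>: "\<sigma> permutes {1..n}" and \<alpha>: "\<alpha> permutes {1..n}"
    and g: "\<And>C. C \<in> components n \<sigma> \<alpha> \<Longrightarrow> genus C \<sigma> \<alpha> = 0"
    using assms by (auto simp: genus_zero_collection_def hypermap_collection_def)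
  let ?Q = "components n \<sigma> \<alpha>"
  note Q = components_eq_classes[OF \<sigma> \<alpha>]
  have part: "partition_on {1..n} ?Q"
    unfolding Q by (rule partition_on_classes[OF equivp_linked linked_class_subset[OF \<sigma> \<alpha>]])
  have inv: "linked \<sigma> \<alpha> y (inv' \<alpha> y)" for y
    using linked_right[of \<sigma> "inv' \<alpha>" y] by (simp add: linked_inv permutes_bij[OF \<alpha>])
  have "\<sigma> ` C \<subseteq> C \<and> \<alpha> ` C \<subseteq> C \<and> (inv' \<alpha> \<circ> \<sigma>) ` C \<subseteq> C" if "C \<in> ?Q" for C
  proof -
    from that obtain x where C: "C = Collect (linked \<sigma> \<alpha> x)" unfolding Q by blast
    have "linked \<sigma> \<alpha> y (inv' \<alpha> (\<sigma> y))" for y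
      by (rule linked_trans[OF linked_left inv])
    then show ?thesis
      unfolding C by (auto intro: linked_trans[OF _ linked_left] linked_trans[OF _ linked_right]
          linked_trans[of \<sigma> \<alpha> x])
  qed
  then have sums: "num_cycles {1..n} \<sigma> = (\<Sum>C\<in>?Q. num_cycles C \<sigma>)"
      "num_cycles {1..n} \<alpha> = (\<Sum>C\<in>?Q. num_cycles C \<alpha>)"
      "num_cycles {1..n} (inv' \<alpha> \<circ> \<sigma>) = (\<Sum>C\<in>?Q. num_cycles C (inv' \<alpha> \<circ> \<sigma>))"
    using num_cycles_partition[OF _ part] by auto
  have "card C + 2 = num_cycles C \<sigma> + num_cycles C \<alpha> + num_cycles C (inv' \<alpha> \<circ> \<sigma>)"
    if "C \<in> ?Q" for C
  proof -
    have "of_nat (card C + 2)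
        = (of_nat (num_cycles C \<sigma> + num_cycles C \<alpha> + num_cycles C (inv' \<alpha> \<circ> \<sigma>)) :: rat)"
      using g[OF that] unfolding genus_def by simp
    then show ?thesis unfolding of_nat_eq_iff .
  qed
  then have "(\<Sum>C\<in>?Q. card C + 2)
      = (\<Sum>C\<in>?Q. num_cycles C \<sigma> + num_cycles C \<alpha> + num_cycles C (inv' \<alpha> \<circ> \<sigma>))"
    by (rule sum.cong[OF refl])
  then have "n + 2 * card ?Q
      = num_cycles {1..n} \<sigma> + num_cycles {1..n} \<alpha> + num_cycles {1..n} (inv' \<alpha> \<circ> \<sigma>)"
    using card_partition_sum[OF _ part] unfolding sums by (simp only: sum.distrib sum_constant) simp
  \<comment> \<open>The genus and the defect use the two orders of the factors.\<close>
  moreover have "num_cycles {1..n} (inv' \<alpha> \<circ> \<sigma>) = num_cycles {1..n} (\<sigma> \<circ> inv' \<alpha>)"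
    using \<sigma> \<alpha> by (intro num_cycles_comp_commute permutes_inv) auto
  moreover have "card ?Q = num_classes {1..n} (linked \<sigma> \<alpha>)"
    using num_components_eq[OF \<sigma> \<alpha>] by (simp add: num_components_def)
  ultimately show ?thesis unfolding defect_def by simp
qed

section \<open>Refinement as a single global cycle count\<close>

lemma perm_restrict_permutes_invariant:
  assumes "\<pi> permutes A" "\<pi> ` C = C"
  shows "perm_restrict \<pi> C permutes C"
proof (rule bij_imp_permutes)
  have "inj_on \<pi> C" using permutes_inj[OF assms(1)] by (rule inj_on_subset) simp
  then show "bij_betw (perm_restrict \<pi> C) C C"
    using assms(2) unfolding bij_betw_def
    by (simp add: perm_restrict_def inj_on_def image_def)
qed (simp add: perm_restrict_def)

lemma num_cycles_perm_restrict:
  assumes "\<pi> ` C \<subseteq> C"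
  shows "num_cycles C (perm_restrict \<pi> C) = num_cycles C \<pi>"
proof -
  have "Orbits.orbit (perm_restrict \<pi> C) x = Orbits.orbit \<pi> x" if "x \<in> C" for x
    using assms that by (intro orbit_cong0[of _ C]) (auto simp: perm_restrict_def)
  then show ?thesis by (simp add: num_cycles_def perm_cycles_def cong: image_cong_simp)
qed

text \<open>On each cycle of \<alpha>, genus zero is the equality case of an inequality. Hence all
  these equalities hold iff their sum does.\<close>

lemma refinement_iff:
  assumes "\<alpha> permutes {1..n}"
  shows "refinement n \<beta> \<alpha> \<longleftrightarrow> \<beta> permutes {1..n} \<and> (\<forall>i\<in>{1..n}. same_cycle \<alpha> i (\<beta> i)) \<and>
    num_cycles {1..n} \<beta> + num_cycles {1..n} (\<alpha> \<circ> inv' \<beta>) = n + num_cycles {1..n} \<alpha>"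
proof (cases "\<beta> permutes {1..n}")
  case \<beta>: True
  have perm: "permutation \<alpha>" "permutation \<beta>"
    using assms \<beta> by (auto simp: permutation_permutes)
  let ?Q = "perm_cycles {1..n} \<alpha>" and ?\<gamma> = "inv' \<beta> \<circ> \<alpha>"
  have Q: "?Q = (\<lambda>x. Collect (same_cycle \<alpha> x)) ` {1..n}"
    by (simp add: perm_cycles_def orbit_eq_same_cycle[OF perm(1)])
  have id: "(\<lambda>x. x) permutes {1..n}" using permutes_id[of "{1..n}"] by (simp add: id_def)
  have part: "partition_on {1..n} ?Q"
    unfolding Q by (rule partition_on_classes[OF equivp_linked linked_class_subset[OF id assms]])
  have fin: "finite ?Q" by (simp add: perm_cycles_def)
  have sub: "C \<subseteq> {1..n}" if "C \<in> ?Q" for C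
    using part that by (auto simp: partition_on_def)
  have \<alpha>C: "\<alpha> ` C = C" if "C \<in> ?Q" for C
  proof (rule endo_inj_surj)
    show "finite C" using sub[OF that] finite_subset by blast
    show "\<alpha> ` C \<subseteq> C"
      using that unfolding Q by (auto intro: linked_trans linked_right)
    show "inj_on \<alpha> C" using permutes_inj[OF assms] by (rule inj_on_subset) simp
  qed
  have inv_iff: "(\<forall>C\<in>?Q. \<beta> ` C = C) \<longleftrightarrow> (\<forall>i\<in>{1..n}. same_cycle \<alpha> i (\<beta> i))" (is "?L \<longleftrightarrow> ?R")
  proof
    assume L: ?L
    show ?R
    proof
      fix i assume "i \<in> {1..n}"
      then have "Collect (same_cycle \<alpha> i) \<in> ?Q" unfolding Q by (rule imageI)
      with L have "\<beta> ` Collect (same_cycle \<alpha> i) = Collect (same_cycle \<alpha> i)" by (rule bspec)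
      moreover have "\<beta> i \<in> \<beta> ` Collect (same_cycle \<alpha> i)" by (intro imageI) simp
      ultimately show "same_cycle \<alpha> i (\<beta> i)" by simp
    qed
  next
    assume R: ?R
    show ?L
    proof
      fix C assume C: "C \<in> ?Q"
      show "\<beta> ` C = C"
      proof (rule endo_inj_surj)
        show "finite C" using sub[OF C] finite_subset by blast
        show "\<beta> ` C \<subseteq> C"
        proof -
          from C obtain x where x: "C = Collect (same_cycle \<alpha> x)" unfolding Q by blast
          have "same_cycle \<alpha> x (\<beta> y)" if "y \<in> C" for y
            using R sub[OF C] that linked_trans[of _ \<alpha> x y "\<beta> y"] unfolding x by blast
          then show ?thesis unfolding x by blast
        qed
        show "inj_on \<beta> C" using permutes_inj[OF \<beta>] by (rule inj_on_subset) simp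
      qed
    qed
  qed
  have "(\<forall>C\<in>?Q. genus C \<alpha> \<beta> = 0) \<longleftrightarrow>
      num_cycles {1..n} \<beta> + num_cycles {1..n} (\<alpha> \<circ> inv' \<beta>) = n + num_cycles {1..n} \<alpha>"
    if L: "\<forall>C\<in>?Q. \<beta> ` C = C"
  proof -
    have \<gamma>C: "?\<gamma> ` C = C" if "C \<in> ?Q" for C
    proof -
      have "?\<gamma> ` C = inv' \<beta> ` (\<beta> ` C)"
        using bspec[OF L that] by (simp only: image_comp[symmetric] \<alpha>C[OF that])
      then show ?thesis by (simp only: image_inv_f_f[OF permutes_inj[OF \<beta>]])
    qed
    have le: "num_cycles C ?\<gamma> + num_cycles C \<beta> \<le> card C + 1" and one: "num_cycles C \<alpha> = 1"
      if C: "C \<in> ?Q" for C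
    proof -
      have fC: "finite C" using sub[OF C] finite_subset by blast
      \<comment> \<open>This factorisation of one cycle of \<alpha> is where the triangle inequality
        for cycle counts enters.\<close>
      have "perm_restrict \<beta> C \<circ> perm_restrict ?\<gamma> C = perm_restrict \<alpha> C"
        using \<gamma>C[OF C] permutes_inverses(1)[OF \<beta>] by (auto simp: fun_eq_iff perm_restrict_def)
      moreover have "num_cycles C (perm_restrict ?\<gamma> C) + num_cycles C (perm_restrict \<beta> C)
          \<le> card C + num_cycles C (perm_restrict \<beta> C \<circ> perm_restrict ?\<gamma> C)"
        using L C \<gamma>C[OF C] assms \<beta>
        by (intro num_cycles_comp_le[OF fC] perm_restrict_permutes_invariant[of _ "{1..n}"]
            permutes_compose permutes_inv) auto
      ultimately have le: "num_cycles C ?\<gamma> + num_cycles C \<beta> \<le> card C + num_cycles C \<alpha>"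
        using L C \<gamma>C \<alpha>C by (simp add: num_cycles_perm_restrict)
      have "perm_cycles C \<alpha> = {C}"
      proof -
        from C obtain x where x: "C = Collect (same_cycle \<alpha> x)" unfolding Q by blast
        have "Orbits.orbit \<alpha> y = C" if "y \<in> C" for y
          using that unfolding orbit_eq_same_cycle[OF perm(1)] x Collect_class_eq_iff[OF equivp_linked]
          by (auto intro: linked_sym)
        moreover have "C \<noteq> {}" using x by auto
        ultimately show ?thesis unfolding perm_cycles_def by auto
      qed
      then show one: "num_cycles C \<alpha> = 1" by (simp add: num_cycles_def)
      show "num_cycles C ?\<gamma> + num_cycles C \<beta> \<le> card C + 1" using le one by simp
    qed
    have genus: "genus C \<alpha> \<beta> = 0 \<longleftrightarrow> num_cycles C ?\<gamma> + num_cycles C \<beta> = card C + 1"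
      if "C \<in> ?Q" for C
    proof -
      have "genus C \<alpha> \<beta> = 0 \<longleftrightarrow>
          (of_nat (card C + 2) :: rat) = of_nat (num_cycles C \<alpha> + num_cycles C \<beta> + num_cycles C ?\<gamma>)"
        unfolding genus_def by (simp add: add.commute)
      also have "\<dots> \<longleftrightarrow> card C + 2 = num_cycles C \<alpha> + num_cycles C \<beta> + num_cycles C ?\<gamma>"
        by (rule of_nat_eq_iff)
      finally show ?thesis using one[OF that] by auto
    qed
    have sums: "num_cycles {1..n} \<beta> = (\<Sum>C\<in>?Q. num_cycles C \<beta>)"
      "num_cycles {1..n} ?\<gamma> = (\<Sum>C\<in>?Q. num_cycles C ?\<gamma>)"
      "(\<Sum>C\<in>?Q. card C) = n" "num_cycles {1..n} \<alpha> = (\<Sum>C\<in>?Q. 1)"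
      using num_cycles_partition[OF _ part] L \<gamma>C card_partition_sum[OF _ part]
      by (auto simp: num_cycles_def)
    \<comment> \<open>By \<open>le\<close> each left term is at most the right one, so equal sums
      force equal terms.\<close>
    have "(\<forall>C\<in>?Q. num_cycles C ?\<gamma> + num_cycles C \<beta> = card C + 1) \<longleftrightarrow>
        (\<Sum>C\<in>?Q. num_cycles C ?\<gamma> + num_cycles C \<beta>) = (\<Sum>C\<in>?Q. card C + 1)"
      using sum_mono_inv[OF _ le _ fin] by (auto intro: sum.cong)
    also have "\<dots> \<longleftrightarrow> num_cycles {1..n} \<beta> + num_cycles {1..n} ?\<gamma> = n + num_cycles {1..n} \<alpha>"
      unfolding sum.distrib sums by (simp only: add.commute)
    finally have sum_iff: "(\<forall>C\<in>?Q. num_cycles C ?\<gamma> + num_cycles C \<beta> = card C + 1) \<longleftrightarrow>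
        num_cycles {1..n} \<beta> + num_cycles {1..n} ?\<gamma> = n + num_cycles {1..n} \<alpha>" .
    have "num_cycles {1..n} ?\<gamma> = num_cycles {1..n} (\<alpha> \<circ> inv' \<beta>)"
      using assms \<beta> by (intro num_cycles_comp_commute permutes_inv) auto
    then show ?thesis using genus sum_iff by metis
  qed
  then show ?thesis
    unfolding refinement_def using \<beta> inv_iff by blast
qed (simp add: refinement_def)

section \<open>States of the medial map\<close>

definition matching_of :: "nat \<Rightarrow> (nat \<Rightarrow> nat) \<Rightarrow> signed_point set set" where
  "matching_of n \<beta> = (\<lambda>i. {Neg i, Pos (inv' \<beta> i)}) ` {1..n}"

lemma mem_matching_of_iff: "{Neg i, Pos j} \<in> matching_of n \<beta> \<longleftrightarrow> i \<in> {1..n} \<and> j = inv' \<beta> i"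
  unfolding matching_of_def by (auto simp: doubleton_eq_iff)

text \<open>The right-hand side lists each block twice, once from either end.\<close>

lemma matching_of_eq_matched_point:
  assumes "\<beta> permutes {1..n}"
  shows "matching_of n \<beta> = (\<lambda>p. {p, matched_point \<beta> p}) ` signed_points n"
proof -
  have "(\<lambda>j. {Pos j, Neg (\<beta> j)}) ` {1..n} = (\<lambda>j. {Neg j, Pos (inv' \<beta> j)}) ` \<beta> ` {1..n}"
    unfolding image_image using permutes_inverses(2)[OF assms] by (simp add: insert_commute)
  then have "(\<lambda>j. {Pos j, Neg (\<beta> j)}) ` {1..n} = matching_of n \<beta>"
    by (simp only: permutes_image[OF assms] matching_of_def)
  then show ?thesis
    unfolding signed_points_def image_Un image_image matched_point.simps
    by (simp only: matching_of_def Un_absorb)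
qed

lemma partition_on_matching_of:
  assumes "\<beta> permutes {1..n}"
  shows "partition_on (signed_points n) (matching_of n \<beta>)"
proof (rule partition_onI)
  have "\<Union> (matching_of n \<beta>) = Neg ` {1..n} \<union> Pos ` inv' \<beta> ` {1..n}"
    unfolding matching_of_def by blast
  then show "\<Union> (matching_of n \<beta>) = signed_points n"
    by (simp only: signed_points_def permutes_image[OF permutes_inv[OF assms]])
  show "disjnt B C" if "B \<in> matching_of n \<beta>" "C \<in> matching_of n \<beta>" "B \<noteq> C" for B C
    using that permutes_inj[OF permutes_inv[OF assms]]
    by (auto simp: matching_of_def disjnt_def dest: injD)
  show "{} \<notin> matching_of n \<beta>"
    by (auto simp: matching_of_def)
qed

lemma Pos_in_orbit_Neg_iff:
  assumes "\<alpha> permutes {1..n}" "i \<in> {1..n}" "j \<in> {1..n}"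
  shows "Pos j \<in> Orbits.orbit (fst (medial_map n \<sigma> \<alpha>)) (Neg i) \<longleftrightarrow> same_cycle \<alpha> i j"
proof -
  have "permutation (fst (medial_map n \<sigma> \<alpha>))"
    using medial_vertex_permutes[OF assms(1)] finite_signed_points by (auto simp: permutation_permutes)
  then show ?thesis
    using assms(2,3) by (simp add: orbit_eq_same_cycle same_cycle_medial_vertex_iff[OF assms(1)])
qed

text \<open>Matching within a vertex says that \<beta> preserves the cycles of \<alpha>, and
  noncrossing is the cycle count; these are the conditions of \<open>refinement_iff\<close>.\<close>

lemma coherent_matching_of_iff:
  assumes "\<alpha> permutes {1..n}" "\<beta> permutes {1..n}"
  shows "coherent_matching n (fst (medial_map n \<sigma> \<alpha>)) (matching_of n \<beta>) \<longleftrightarrow> refinement n \<beta> \<alpha>"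
proof -
  let ?\<zeta> = "fst (medial_map n \<sigma> \<alpha>)"
  have inv: "inv' \<beta> i \<in> {1..n}" if "i \<in> {1..n}" for i
    using that permutes_in_image[OF permutes_inv[OF assms(2)]] by blast
  have "(\<forall>B\<in>matching_of n \<beta>. \<exists>i j. B = {Neg i, Pos j} \<and> Pos j \<in> Orbits.orbit ?\<zeta> (Neg i)) \<longleftrightarrow>
      (\<forall>i\<in>{1..n}. Pos (inv' \<beta> i) \<in> Orbits.orbit ?\<zeta> (Neg i))"
    unfolding matching_of_def by (auto simp: doubleton_eq_iff)
  also have "\<dots> \<longleftrightarrow> (\<forall>i\<in>{1..n}. same_cycle \<alpha> i (inv' \<beta> i))"
    using Pos_in_orbit_Neg_iff[OF assms(1) _ inv] by (intro ball_cong refl) blast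
  \<comment> \<open>Reindexing by \<beta> turns the condition on \<open>inv' \<beta>\<close> into
    one on \<beta>.\<close>
  also have "\<dots> \<longleftrightarrow> (\<forall>i\<in>\<beta> ` {1..n}. same_cycle \<alpha> i (inv' \<beta> i))"
    by (simp only: permutes_image[OF assms(2)])
  also have "\<dots> \<longleftrightarrow> (\<forall>i\<in>{1..n}. same_cycle \<alpha> i (\<beta> i))"
    using linked_sym by (force simp: permutes_inverses[OF assms(2)])
  finally show ?thesis
    unfolding coherent_matching_def refinement_iff[OF assms(1)]
    using partition_on_matching_of[OF assms(2)] noncrossing_matched_point_iff[OF assms, of \<sigma>]
      matching_of_eq_matched_point[OF assms(2)] assms(2) by auto
qed

text \<open>A partition into pairs of opposite sign is the graph of a bijection \<open>m\<close>
  from negative to positive points; \<beta> is its inverse.\<close>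

lemma coherent_matching_obtains:
  assumes "coherent_matching n f \<mu>"
  obtains \<beta> where "\<beta> permutes {1..n}" "\<mu> = matching_of n \<beta>"
proof -
  have part: "partition_on (signed_points n) \<mu>"
    and blocks: "\<And>B. B \<in> \<mu> \<Longrightarrow> \<exists>i j. B = {Neg i, Pos j}"
    using assms unfolding coherent_matching_def by blast+
  have union: "\<Union>\<mu> = signed_points n" and disj: "\<And>B C x. B \<in> \<mu> \<Longrightarrow> C \<in> \<mu> \<Longrightarrow> x \<in> B \<Longrightarrow> x \<in> C \<Longrightarrow> B = C"
    using part by (auto simp: partition_on_def disjoint_def)
  have "\<exists>j. {Neg i, Pos j} \<in> \<mu>" if "i \<in> {1..n}" for i
  proof -
    have "Neg i \<in> \<Union>\<mu>" using that unfolding union by simp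
    then obtain B where "B \<in> \<mu>" "Neg i \<in> B" by blast
    with blocks[of B] show ?thesis by auto
  qed
  then obtain m' where m': "\<And>i. i \<in> {1..n} \<Longrightarrow> {Neg i, Pos (m' i)} \<in> \<mu>" by metis
  \<comment> \<open>The choice \<open>m'\<close> is arbitrary off \<open>{1..n}\<close>, where a
    permutation has to be the identity.\<close>
  define m where "m i = (if i \<in> {1..n} then m' i else i)" for i
  have m: "{Neg i, Pos (m i)} \<in> \<mu>" if "i \<in> {1..n}" for i
    using m'[OF that] that by (simp add: m_def)
  have "m permutes {1..n}"
  proof (rule inj_imp_permutes)
    show "inj_on m {1..n}"
    proof (rule inj_onI)
      fix i j assume ij: "i \<in> {1..n}" "j \<in> {1..n}" "m i = m j"
      then have "{Neg i, Pos (m i)} = {Neg j, Pos (m j)}"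
        by (intro disj[OF m m, where x = "Pos (m i)"]) auto
      then show "i = j" by (simp add: doubleton_eq_iff)
    qed
    show "m i \<in> {1..n}" if "i \<in> {1..n}" for i
    proof -
      have "Pos (m i) \<in> \<Union>\<mu>" using m[OF that] by blast
      then show ?thesis unfolding union by simp
    qed
  qed (auto simp: m_def)
  moreover have "\<mu> = matching_of n (inv' m)"
  proof -
    have "\<mu> = (\<lambda>i. {Neg i, Pos (m i)}) ` {1..n}"
    proof (rule subset_antisym)
      show "\<mu> \<subseteq> (\<lambda>i. {Neg i, Pos (m i)}) ` {1..n}"
      proof
        fix B assume B: "B \<in> \<mu>"
        then obtain i j where ij: "B = {Neg i, Pos j}" using blocks by blast
        then have "Neg i \<in> \<Union>\<mu>" using B by blast
        then have i: "i \<in> {1..n}" unfolding union by simp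
        have "B = {Neg i, Pos (m i)}"
          by (rule disj[OF B m[OF i], of "Neg i"]) (simp_all add: ij)
        with i show "B \<in> (\<lambda>i. {Neg i, Pos (m i)}) ` {1..n}" by (rule rev_image_eqI)
      qed
    qed (use m in blast)
    then show ?thesis
      unfolding matching_of_def using \<open>m permutes {1..n}\<close> by (simp add: permutes_inv_inv)
  qed
  ultimately show ?thesis using that permutes_inv by blast
qed

lemma coherent_matchings_eq:
  assumes "\<alpha> permutes {1..n}"
  shows "{\<mu>. coherent_matching n (fst (medial_map n \<sigma> \<alpha>)) \<mu>}
    = matching_of n ` {\<beta>. refinement n \<beta> \<alpha>}"
proof (rule Set.set_eqI)
  fix \<mu>
  have "coherent_matching n (fst (medial_map n \<sigma> \<alpha>)) \<mu> \<longleftrightarrow>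
      (\<exists>\<beta>. refinement n \<beta> \<alpha> \<and> \<mu> = matching_of n \<beta>)"
    using coherent_matching_of_iff[OF assms] coherent_matching_obtains
    by (metis refinement_def)
  then show "\<mu> \<in> {\<mu>. coherent_matching n (fst (medial_map n \<sigma> \<alpha>)) \<mu>}
      \<longleftrightarrow> \<mu> \<in> matching_of n ` {\<beta>. refinement n \<beta> \<alpha>}" by blast
qed

lemma inj_on_matching_of: "inj_on (matching_of n) {\<beta>. \<beta> permutes {1..n}}"
proof (rule inj_onI; unfold mem_Collect_eq)
  fix \<beta> \<gamma> assume \<beta>: "\<beta> permutes {1..n}" and \<gamma>: "\<gamma> permutes {1..n}"
    and eq: "matching_of n \<beta> = matching_of n \<gamma>"
  have "inv' \<beta> i = inv' \<gamma> i" for i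
  proof (cases "i \<in> {1..n}")
    case True
    then have "{Neg i, Pos (inv' \<beta> i)} \<in> matching_of n \<gamma>"
      unfolding eq[symmetric] by (simp only: mem_matching_of_iff)
    then show ?thesis by (simp only: mem_matching_of_iff)
  next
    case False
    then show ?thesis
      using permutes_not_in[OF permutes_inv[OF \<beta>]] permutes_not_in[OF permutes_inv[OF \<gamma>]] by metis
  qed
  then have "inv' \<beta> = inv' \<gamma>" by blast
  then show "\<beta> = \<gamma>" using permutes_inv_inv[OF \<beta>] permutes_inv_inv[OF \<gamma>] by metis
qed

text \<open>The walk alternates signs, and two steps from \<open>Neg i\<close> lead to
  \<open>Neg (\<sigma> (inv' \<beta> i))\<close>. So the negative points of a closed path form one
  cycle of \<open>\<sigma> \<circ> inv' \<beta>\<close>.\<close>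

lemma num_cycles_state_walk:
  assumes "\<sigma> permutes {1..n}" "\<beta> permutes {1..n}"
  shows "num_cycles (signed_points n) (state_walk (snd (medial_map n \<sigma> \<alpha>)) (matching_of n \<beta>))
    = num_cycles {1..n} (\<sigma> \<circ> inv' \<beta>)"
proof -
  let ?A = "signed_points n"
  \<comment> \<open>\<open>w\<close> is junk off the signed points, hence the restriction \<open>\<omega>\<close>.\<close>
  define w where "w = state_walk (snd (medial_map n \<sigma> \<alpha>)) (matching_of n \<beta>)"
  define \<omega> where "\<omega> = perm_restrict w ?A"
  define g where "g = \<sigma> \<circ> inv' \<beta>"
  \<comment> \<open>For a signed point \<open>p\<close>, this is the index of the first negative
    point met by the walk from \<open>p\<close>, with \<open>p\<close> itself included.\<close>
  define h where "h p = (case p of Neg i \<Rightarrow> i | Pos j \<Rightarrow> \<sigma> j)" for p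
  have inv: "inv' \<beta> i \<in> {1..n} \<longleftrightarrow> i \<in> {1..n}" for i
    by (rule permutes_in_image[OF permutes_inv[OF assms(2)]])
  have \<sigma>: "\<sigma> i \<in> {1..n} \<longleftrightarrow> i \<in> {1..n}" for i
    by (rule permutes_in_image[OF assms(1)])
  have w: "w (Neg i) = Pos (inv' \<beta> i)" "w (Pos i) = Neg (\<sigma> i)" if "i \<in> {1..n}" for i
    using that unfolding w_def state_walk_def mem_matching_of_iff
    by (simp_all add: medial_map_def perm_restrict_def)
  have \<omega>: "\<omega> (Neg i) = (if i \<in> {1..n} then Pos (inv' \<beta> i) else Neg i)"
    "\<omega> (Pos i) = (if i \<in> {1..n} then Neg (\<sigma> i) else Pos i)" for i
    unfolding \<omega>_def perm_restrict_def by (cases "i \<in> {1..n}"; simp only: signed_points_iff w if_True if_False)+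
  have "\<omega> permutes ?A"
  proof (rule inj_imp_permutes)
    show "inj_on \<omega> ?A"
    proof (rule inj_onI)
      fix p q assume "p \<in> ?A" "q \<in> ?A" "\<omega> p = \<omega> q"
      then show "p = q"
        using permutes_inj[OF assms(1)] permutes_inj[OF permutes_inv[OF assms(2)]]
        by (cases p; cases q) (auto simp: \<omega> dest: injD split: if_splits)
    qed
    show "\<omega> p \<in> ?A" if "p \<in> ?A" for p
      using that inv \<sigma> by (cases p) (auto simp: \<omega>)
    show "\<omega> p = p" if "p \<notin> ?A" for p
      using that by (simp add: \<omega>_def perm_restrict_def)
  qed (rule finite_signed_points)
  then have perm: "permutation \<omega>" and w_image: "w ` ?A \<subseteq> ?A"
    using finite_signed_points permutes_image[of \<omega> ?A]
    by (auto simp: permutation_permutes \<omega>_def perm_restrict_def)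
  have g_perm: "permutation g"
    unfolding g_def using assms
    by (auto simp: permutation_permutes intro!: permutes_compose permutes_inv)
  have NN: "same_cycle \<omega> (Neg i) (Neg (g i))" for i
  proof (cases "i \<in> {1..n}")
    case True
    then have "\<omega> (\<omega> (Neg i)) = Neg (g i)" using inv[of i] by (simp only: \<omega> if_True g_def comp_apply)
    then show ?thesis
      by (metis linked_right linked_trans)
  next
    case False
    then have "g i = i"
      using permutes_not_in[OF assms(1)] permutes_not_in[OF permutes_inv[OF assms(2)]]
      by (simp add: g_def)
    then show ?thesis by simp
  qed
  have "equivp (\<lambda>i j. same_cycle \<omega> (Neg i) (Neg j))"
    by (intro equivpI reflpI sympI transpI) (auto intro: linked_sym linked_trans)
  then have 1: "same_cycle \<omega> (Neg i) (Neg j)" if "same_cycle g i j" for i j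
    by (rule linked_least[where \<sigma> = "\<lambda>x. x" and \<beta> = g and E = "\<lambda>i j. same_cycle \<omega> (Neg i) (Neg j)"])
      (use that NN in auto)
  \<comment> \<open>On signed points, a step from a negative point applies \<open>g\<close> to
    \<open>h p\<close>; one from a positive point leaves it unchanged.\<close>
  have "same_cycle g (h p) (h (\<omega> p))" for p
    using linked_right[of "\<lambda>x. x" g "h p"] by (cases p) (auto simp: \<omega> h_def g_def)
  moreover have "equivp (\<lambda>p q. same_cycle g (h p) (h q))"
    by (intro equivpI reflpI sympI transpI) (auto intro: linked_sym linked_trans)
  ultimately have 2: "same_cycle g (h p) (h q)" if "same_cycle \<omega> p q" for p q
    using linked_least[where \<sigma> = "\<lambda>x. x" and \<beta> = \<omega> and E = "\<lambda>p q. same_cycle g (h p) (h q)"] that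
    by blast
  have 3: "same_cycle \<omega> (Neg (h p)) p" if "p \<in> ?A" for p
  proof (cases p)
    case (Pos j)
    then have "\<omega> p = Neg (h p)" using that by (simp add: \<omega> h_def)
    then show ?thesis by (metis linked_right linked_sym)
  qed (simp add: h_def)
  have "h ` ?A = {1..n}"
    unfolding signed_points_def image_Un image_image h_def
    by (simp only: signed_point.case image_ident permutes_image[OF assms(1)] Un_absorb)
  then have "num_classes {1..n} (same_cycle g) = num_classes ?A (same_cycle \<omega>)"
    by (rule num_classes_image[OF _ equivp_linked equivp_linked])
      (use 1 2 3 in \<open>meson linked_sym linked_trans\<close>)
  then have "num_cycles {1..n} g = num_cycles ?A \<omega>"
    by (simp add: num_cycles_eq_num_classes perm g_perm)
  also have "\<dots> = num_cycles ?A w"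
    unfolding \<omega>_def by (rule num_cycles_perm_restrict[OF w_image])
  finally show ?thesis unfolding g_def w_def by simp
qed

text \<open>Refinements correspond bijectively to coherent matchings, so \<open>num_states\<close>
  counts the fibres of \<open>f\<close>, and the polynomial is a sum over refinements grouped by
  fibre.\<close>

lemma circuit_partition_poly_eq_sum:
  assumes "\<sigma> permutes {1..n}" "\<alpha> permutes {1..n}"
  shows "circuit_partition_poly n (medial_map n \<sigma> \<alpha>)
    = (\<Sum>\<beta> | refinement n \<beta> \<alpha>. monom 1 (num_cycles {1..n} (\<sigma> \<circ> inv' \<beta>)))"
proof -
  let ?R = "{\<beta>. refinement n \<beta> \<alpha>}"
  define f where "f \<beta> = num_cycles {1..n} (\<sigma> \<circ> inv' \<beta>)" for \<beta> :: "nat \<Rightarrow> nat"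
  have R: "?R \<subseteq> {\<beta>. \<beta> permutes {1..n}}" by (auto simp: refinement_def)
  have fin: "finite ?R" by (rule finite_subset[OF R finite_permutations]) simp
  have states: "num_states n (medial_map n \<sigma> \<alpha>) k = card {\<beta> \<in> ?R. f \<beta> = k}" for k
  proof -
    have "{\<mu>. coherent_matching n (fst (medial_map n \<sigma> \<alpha>)) \<mu> \<and>
        num_cycles (signed_points n) (state_walk (snd (medial_map n \<sigma> \<alpha>)) \<mu>) = k}
      = {\<mu> \<in> matching_of n ` ?R.
        num_cycles (signed_points n) (state_walk (snd (medial_map n \<sigma> \<alpha>)) \<mu>) = k}"
      using coherent_matchings_eq[OF assms(2), of \<sigma>] by blast
    also have "\<dots> = matching_of n ` {\<beta> \<in> ?R. f \<beta> = k}"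
      using num_cycles_state_walk[OF assms(1)] R unfolding f_def by auto
    finally have "num_states n (medial_map n \<sigma> \<alpha>) k = card (matching_of n ` {\<beta> \<in> ?R. f \<beta> = k})"
      unfolding num_states_def by (rule arg_cong)
    also have "\<dots> = card {\<beta> \<in> ?R. f \<beta> = k}"
      using R by (intro card_image inj_on_subset[OF inj_on_matching_of]) blast
    finally show ?thesis .
  qed
  have "{k. num_states n (medial_map n \<sigma> \<alpha>) k \<noteq> 0} = f ` ?R"
    using fin by (auto simp: states)
  moreover have "(\<Sum>\<beta> | \<beta> \<in> ?R \<and> f \<beta> = k. monom 1 (f \<beta>))
      = monom (int (num_states n (medial_map n \<sigma> \<alpha>) k)) k" for k
    by (simp add: states of_nat_monom mult_monom flip: of_nat_mult)
  ultimately show ?thesis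
    unfolding circuit_partition_poly_def f_def[symmetric] by (simp add: sum.image_gen[OF fin, of _ f])
qed

text \<open>With \<gamma> = \<open>\<alpha> \<circ> inv' \<beta>\<close> the refinement equation is
  the hypothesis of \<open>defect_mono\<close>, so the defect of \<beta> lies between 0 and that of
  \<alpha>, which is 0.\<close>

lemma defect_refinement:
  assumes "genus_zero_collection n \<sigma> \<alpha>" "refinement n \<beta> \<alpha>"
  shows "defect {1..n} \<sigma> \<beta> = 0"
proof -
  have \<sigma>: "\<sigma> permutes {1..n}" and \<alpha>: "\<alpha> permutes {1..n}"
    using assms(1) by (auto simp: genus_zero_collection_def hypermap_collection_def)
  have \<beta>: "\<beta> permutes {1..n}"
    and eq: "num_cycles {1..n} \<beta> + num_cycles {1..n} (\<alpha> \<circ> inv' \<beta>) = n + num_cycles {1..n} \<alpha>"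
    using assms(2) by (simp_all add: refinement_iff[OF \<alpha>])
  have comp: "(\<alpha> \<circ> inv' \<beta>) \<circ> \<beta> = \<alpha>"
    by (simp add: fun_eq_iff permutes_inverses[OF \<beta>])
  have card: "card {1..n} = n" by simp
  have "defect {1..n} \<sigma> \<beta> \<le> defect {1..n} \<sigma> ((\<alpha> \<circ> inv' \<beta>) \<circ> \<beta>)"
    by (rule defect_mono[OF _ permutes_compose[OF permutes_inv[OF \<beta>] \<alpha>] \<sigma> \<beta>])
      (simp_all only: comp eq finite_atLeastAtMost card)
  then show ?thesis
    using defect_genus_zero[OF assms(1)] defect_nonneg[OF _ \<sigma> \<beta>] unfolding comp by simp
qed

text \<open>Genus zero rewrites the exponent of \<open>v\<close> as \<open>num_cycles {1..n}
  (\<sigma> \<circ> inv' \<beta>) - num_components n \<sigma> \<beta>\<close>. Two inequalities on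
  component numbers show that no subtraction truncates.\<close>

lemma whitney_exponent:
  assumes "genus_zero_collection n \<sigma> \<alpha>" "refinement n \<beta> \<alpha>"
  shows "num_components n \<sigma> \<alpha> +
      ((num_components n \<sigma> \<beta> - num_components n \<sigma> \<alpha>) +
       (num_components n \<sigma> \<beta> + n - num_cycles {1..n} \<beta> - num_cycles {1..n} \<sigma>))
    = num_cycles {1..n} (\<sigma> \<circ> inv' \<beta>)"
proof -
  have \<sigma>: "\<sigma> permutes {1..n}" and \<alpha>: "\<alpha> permutes {1..n}"
    using assms(1) by (auto simp: genus_zero_collection_def hypermap_collection_def)
  have \<beta>: "\<beta> permutes {1..n}" and sc: "\<forall>i\<in>{1..n}. same_cycle \<alpha> i (\<beta> i)"
    using assms(2) by (simp_all add: refinement_iff[OF \<alpha>])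
  have perm: "permutation (\<sigma> \<circ> inv' \<beta>)"
    using \<sigma> \<beta> by (auto simp: permutation_permutes intro!: permutes_compose permutes_inv)
  have "same_cycle \<alpha> i (\<beta> i)" for i
    using sc permutes_not_in[OF \<beta>] by (cases "i \<in> {1..n}") auto
  then have "linked \<sigma> \<beta> x y \<Longrightarrow> linked \<sigma> \<alpha> x y" for x y
    by (rule linked_mono[OF linked_left same_cycle_imp_linked])
  then have "num_components n \<sigma> \<alpha> \<le> num_components n \<sigma> \<beta>"
    unfolding num_components_eq[OF \<sigma> \<alpha>] num_components_eq[OF \<sigma> \<beta>]
    by (intro num_classes_antimono equivp_linked) auto
  moreover have "linked \<sigma> \<beta> x ((\<sigma> \<circ> inv' \<beta>) x)" for x
    using linked_trans[OF linked_right[of \<sigma> "inv' \<beta>" x, unfolded linked_inv[OF permutes_bij[OF \<beta>]]]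
        linked_left[of \<sigma> \<beta> "inv' \<beta> x"]] by simp
  then have "same_cycle (\<sigma> \<circ> inv' \<beta>) x y \<Longrightarrow> linked \<sigma> \<beta> x y" for x y
    by (rule linked_mono[OF linked_refl])
  then have "num_components n \<sigma> \<beta> \<le> num_cycles {1..n} (\<sigma> \<circ> inv' \<beta>)"
    unfolding num_components_eq[OF \<sigma> \<beta>] num_cycles_eq_num_classes[OF perm]
    by (intro num_classes_antimono equivp_linked) auto
  moreover have "n + 2 * num_components n \<sigma> \<beta>
      = num_cycles {1..n} \<sigma> + num_cycles {1..n} \<beta> + num_cycles {1..n} (\<sigma> \<circ> inv' \<beta>)"
    using defect_refinement[OF assms] unfolding defect_def num_components_eq[OF \<sigma> \<beta>] by simp
  ultimately show ?thesis by linarith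
qed

section \<open>Setting both variables of the Whitney polynomial equal to \<open>x\<close>\<close>

lemma subst_poly2_X: "subst_poly2 P [:0, 1:] [:0, 1:] = poly P [:0, 1:]"
  by (simp add: subst_poly2_def pcompose_idR)

lemma X_power_eq_monom: "[:0, 1:] ^ k = monom (1 :: int) k"
  by (simp add: monom_altdef)

theorem theorem3p8:
  fixes n :: nat and \<sigma> \<alpha> :: "nat \<Rightarrow> nat"
  assumes "genus_zero_collection n \<sigma> \<alpha>"
  shows "circuit_partition_poly n (medial_map n \<sigma> \<alpha>) =
           [:0, 1:] ^ num_components n \<sigma> \<alpha> * subst_poly2 (whitney_poly n \<sigma> \<alpha>) [:0, 1:] [:0, 1:]"
proof -
  have \<sigma>: "\<sigma> permutes {1..n}" and \<alpha>: "\<alpha> permutes {1..n}"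
    using assms by (auto simp: genus_zero_collection_def hypermap_collection_def)
  have "[:0, 1:] ^ num_components n \<sigma> \<alpha> * subst_poly2 (whitney_poly n \<sigma> \<alpha>) [:0, 1:] [:0, 1:]
      = (\<Sum>\<beta> | refinement n \<beta> \<alpha>. monom 1 (num_components n \<sigma> \<alpha> +
          ((num_components n \<sigma> \<beta> - num_components n \<sigma> \<alpha>) +
           (num_components n \<sigma> \<beta> + n - num_cycles {1..n} \<beta> - num_cycles {1..n} \<sigma>))))"
    unfolding subst_poly2_X whitney_poly_def poly_sum poly_monom X_power_eq_monom sum_distrib_left
    by (simp add: mult_monom add.commute add.left_commute)
  also have "\<dots> = (\<Sum>\<beta> | refinement n \<beta> \<alpha>. monom 1 (num_cycles {1..n} (\<sigma> \<circ> inv' \<beta>)))"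
    by (rule sum.cong[OF refl]) (simp only: mem_Collect_eq whitney_exponent[OF assms])
  also have "\<dots> = circuit_partition_poly n (medial_map n \<sigma> \<alpha>)"
    by (rule circuit_partition_poly_eq_sum[OF \<sigma> \<alpha>, symmetric])
  finally show ?thesis ..
qed

end
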